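(* Let $\mathbb{K}$ be a field of characteristic $0$, let $A=A(\alpha,\beta,0)$ be a down-up algebra such that the roots $r_1,r_2$ of $t^2-\alpha t-\beta$ lie in $\mathbb{K}$, and let $w_1=\beta ud+r_1du$. (1) If $A$ belongs to (F1), then $HH_0(A)$ has a basis formed by the classes of the elements of $\{1\}\cup\{w_1^j,d^j,u^j : j\ge1\}$. (2) If $A$ belongs to (F2), define $n$ to be the (multiplicative) order of $r_1$ if $r_1$ is a root of unity and $n=0$ otherwise. Then $HH_0(A)$ has a basis formed by the classes of the following elements (here $i,j,k$ are nonnegative integers). - If $n$ is even and $n\neq2$ (this includes $n=0$): (i) $u^iw_1^jd^k$ such that $n$ divides $j-i$ and $j-k$; (ii) $u^i$ and $d^k$ with $n\nmid i$ and $n\nmid k$; (iii) $w_1^j$ with $j$ any odd number. - If $n$ is odd and $n\neq1$: (i) $u^iw_1^jd^k$ such that $n$ divides $j-i$ and $j-k$; (ii) $u^i$ and $d^k$ with $n\nmid i$ and $n\nmid k$; (iii) $w_1^j$ with $j$ odd and $j\le n-2$. - If $n=2$: $u^{2i}d^{2k}$, $u^{2i+1}$, $d^{2k+1}$, $w_1^{2j+1}$ with $i,j,k\ge0$. - If $n=1$: $u^id^k$ with $i,k\ge0$.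
   Context: The down-up algebra $A(\alpha,\beta,0)$ over a field $\mathbb{K}$ of characteristic $0$ is the quotient of $\mathbb{K}\langle u,d\rangle$ by the relations $d^2u=\alpha dud+\beta ud^2$ and $du^2=\alpha udu+\beta u^2d$. $HH_0(A)=A/[A,A]$, where $[A,A]$ is the linear span of the commutators. Divisibility by $n=0$ means being equal to $0$. With $r_1,r_2$ the roots of $t^2-\alpha t-\beta$: (F1) $(\alpha,\beta)\neq(0,0)$, $r_1$ and $r_2$ are nonzero, and $r_1^ir_2^j\neq1$ for all integers $i,j$ with $(i,j)\neq(0,0)$; (F2) $\beta=-1$, in which case $r_2=r_1^{-1}$. *)

theory Defs
  imports
    "HOL-Library.Poly_Mapping"
    "HOL-Computational_Algebra.Polynomial"
    "HOL-Algebra.QuotRing"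
    "Jordan_Normal_Form.VS_Connect"
begin

text \<open>
  The free algebra on two generators is the monoid algebra of the monoid of words, i.e. the type of
  finitely supported functions from words to scalars with the convolution product of
  \<^theory>\<open>HOL-Library.Poly_Mapping\<close>.  That theory writes the key monoid additively, so concatenation
  of words is written as \<open>+\<close>.
\<close>

datatype gen = U | D

datatype word = Word "gen list"

instantiation word :: monoid_add
begin

definition zero_word :: word where
  "0 = Word []"

fun plus_word :: "word \<Rightarrow> word \<Rightarrow> word" where
  "Word v + Word w = Word (v @ w)"

instance
proof
  fix a b c :: word
  show "a + b + c = a + (b + c)" by (cases a; cases b; cases c) simp
  show "0 + a = a" "a + 0 = a" by (cases a; simp add: zero_word_def)+
qed

end

type_synonym 'k free_alg = "word \<Rightarrow>\<^sub>0 'k"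

definition free_gen :: "gen \<Rightarrow> 'k::field free_alg" where
  "free_gen x = Poly_Mapping.single (Word [x]) 1"

definition free_smult :: "'k::field \<Rightarrow> 'k free_alg \<Rightarrow> 'k free_alg" where
  "free_smult c = Poly_Mapping.map ((*) c)"

definition free_algebra :: "('k::field, 'k free_alg) module" where
  "free_algebra = \<lparr>carrier = UNIV, mult = (*), one = 1, zero = 0, add = (+), smult = free_smult\<rparr>"


text \<open>Quotients by a subspace and by a two-sided ideal; the elements are cosets.\<close>

definition quot_smult :: "('k, 'v, 'm) module_scheme \<Rightarrow> 'v set \<Rightarrow> 'k \<Rightarrow> 'v set \<Rightarrow> 'v set" where
  "quot_smult M N c X = (\<Union>x\<in>X. N +>\<^bsub>M\<^esub> (c \<odot>\<^bsub>M\<^esub> x))"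

definition quot_algebra :: "('k, 'v, 'm) module_scheme \<Rightarrow> 'v set \<Rightarrow> ('k, 'v set) module" where
  "quot_algebra A I =
     \<lparr>carrier = a_rcosets\<^bsub>A\<^esub> I, mult = rcoset_mult A I, one = I +>\<^bsub>A\<^esub> \<one>\<^bsub>A\<^esub>,
      zero = I, add = set_add A, smult = quot_smult A I\<rparr>"

text \<open>The record type forces \<open>mult\<close> and \<open>one\<close> to be present, but they play no role in a vector space.\<close>

definition quot_space :: "('k, 'v, 'm) module_scheme \<Rightarrow> 'v set \<Rightarrow> ('k, 'v set) module" where
  "quot_space M N =
     \<lparr>carrier = a_rcosets\<^bsub>M\<^esub> N, mult = undefined, one = undefined,
      zero = N, add = set_add M, smult = quot_smult M N\<rparr>"


definition commutator_space :: "('k::field, 'v, 'm) module_scheme \<Rightarrow> 'v set" where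
  "commutator_space A =
     LinearCombinations.module.span class_ring A
       {a \<otimes>\<^bsub>A\<^esub> b \<ominus>\<^bsub>A\<^esub> b \<otimes>\<^bsub>A\<^esub> a | a b. a \<in> carrier A \<and> b \<in> carrier A}"

definition HH0 :: "('k::field, 'v, 'm) module_scheme \<Rightarrow> ('k, 'v set) module" where
  "HH0 A = quot_space A (commutator_space A)"

definition HH0_class :: "('k::field, 'v, 'm) module_scheme \<Rightarrow> 'v \<Rightarrow> 'v set" where
  "HH0_class A x = commutator_space A +>\<^bsub>A\<^esub> x"

text \<open>Distinct elements of \<open>B\<close> are required to have distinct classes.\<close>

definition classes_form_basis_HH0 :: "('k::field, 'v, 'm) module_scheme \<Rightarrow> 'v set \<Rightarrow> bool" where
  "classes_form_basis_HH0 A B \<longleftrightarrow>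
     inj_on (HH0_class A) B \<and> vectorspace.basis class_ring (HH0 A) (HH0_class A ` B)"


definition down_up_ideal :: "'k::field \<Rightarrow> 'k \<Rightarrow> 'k free_alg set" where
  "down_up_ideal \<alpha> \<beta> =
     (let u = free_gen U; d = free_gen D in
      Idl\<^bsub>free_algebra\<^esub>
        {d * d * u - (free_smult \<alpha> (d * u * d) + free_smult \<beta> (u * d * d)),
         d * u * u - (free_smult \<alpha> (u * d * u) + free_smult \<beta> (u * u * d))})"

text \<open>This is \<open>A(\<alpha>, \<beta>, 0)\<close>.\<close>

definition down_up_algebra :: "'k::field \<Rightarrow> 'k \<Rightarrow> ('k, 'k free_alg set) module" where
  "down_up_algebra \<alpha> \<beta> = quot_algebra free_algebra (down_up_ideal \<alpha> \<beta>)"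

definition down_up_gen :: "'k::field \<Rightarrow> 'k \<Rightarrow> gen \<Rightarrow> 'k free_alg set" where
  "down_up_gen \<alpha> \<beta> x = down_up_ideal \<alpha> \<beta> +>\<^bsub>free_algebra\<^esub> free_gen x"


definition family_F1 :: "'k::field \<Rightarrow> 'k \<Rightarrow> 'k \<Rightarrow> 'k \<Rightarrow> bool" where
  "family_F1 \<alpha> \<beta> r1 r2 \<longleftrightarrow>
     (\<alpha>, \<beta>) \<noteq> (0, 0) \<and> r1 \<noteq> 0 \<and> r2 \<noteq> 0 \<and>
     (\<forall>i j :: int. (i, j) \<noteq> (0, 0) \<longrightarrow> r1 powi i * r2 powi j \<noteq> 1)"

definition family_F2 :: "'k::field \<Rightarrow> bool" where
  "family_F2 \<beta> \<longleftrightarrow> \<beta> = -1"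

text \<open>
  The multiplicative order, with value \<open>0\<close> if the element is not a root of unity;
  \<open>0 dvd m\<close> then means \<open>m = 0\<close>.
\<close>

definition mult_order :: "'k::field \<Rightarrow> nat" where
  "mult_order x = (if \<exists>m>0. x ^ m = 1 then LEAST m. m > 0 \<and> x ^ m = 1 else 0)"

end

theory Submission
  imports Defs
begin

text \<open>
  A set of elements of \<open>A\<close> represents a basis of \<open>A / [A, A]\<close> iff every element has a dual trace
  functional on the set and a trace functional that vanishes on the set is zero.  A trace functional is
  determined by its values \<open>F i j k\<close> on the monomials \<open>u\<^sup>i w\<^sup>j d\<^sup>k\<close>, and the possible \<open>F\<close> are the
  solutions of
    \<open>(1 - q\<^sup>j p\<^sup>k) F (i + 1) j k = c\<^sub>k F i (j + 1) (k - 1)\<close> and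
    \<open>(1 - p\<^sup>i q\<^sup>j) F i j (k + 1) = c\<^sub>i F (i - 1) (j + 1) k\<close>,
  where \<open>q = r1\<close>, \<open>p = r2\<close> and \<open>d u\<^sup>i = p\<^sup>i u\<^sup>i d + c\<^sub>i u\<^sup>i\<^sup>-\<^sup>1 w\<close>.  Conversely a solution defines a functional through
  the action of the free algebra on functions on triples that is transpose to left multiplication, so
  neither the linear independence of the monomials nor the diamond lemma is needed.
  The equations decouple into lines \<open>(i - m, j + m, k - m)\<close>, along which they are solved by recursion;
  the number of solutions on a line depends on where the coefficients vanish.
\<close>

section \<open>Bases of quotients via functionals\<close>

text \<open>Each step of a line, from (i, j + 1, k) to (i + 1, j, k + 1), carries two equations
  between the same two values, with coefficients 1 - q^j p^(k+1), c_(k+1) and 1 - p^(i+1) q^j,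
  c_(i+1). They agree when i = k, or when i - k is a period of the sequences p^l and c_l. Into a
  boundary point (i, j, 0) or (0, j, k) other than (0, j, 0) leads only (1 - q^j) F = 0; no equation
  leads into (0, j, 0). Under (F1), 1 - q^a p^b vanishes only for a = b = 0, which leaves the
  starting points (0, j, 0) and the end points (i, 0, 0), (0, 0, k). Under (F2), p = 1/q, so 1 - q^j
  p^k vanishes iff j and k are congruent modulo n, and for q^2 \<noteq> 1 the coefficient c_k is a
  multiple of q^k - p^k and vanishes iff n divides 2k. A value is free where all equations into its
  point have zero coefficient; a zero coefficient facing a nonzero c_k forces the preceding value to
  be 0. For q = 1 and q = -1, c_k is k or (-1)^k k, nonzero for k > 0 in characteristic 0, which
  gives a different pattern.\<close>

locale linear_surjection = vector_space scale
  for scale :: "'k::field \<Rightarrow> 'a::ab_group_add \<Rightarrow> 'a" +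
  fixes V :: "('k, 'v, 'm) module_scheme" and \<pi> :: "'a \<Rightarrow> 'v"
  assumes carrier_eq: "carrier V = range \<pi>"
    and map_add: "\<pi> x \<oplus>\<^bsub>V\<^esub> \<pi> y = \<pi> (x + y)"
    and map_zero: "\<zero>\<^bsub>V\<^esub> = \<pi> 0"
    and map_scale: "c \<odot>\<^bsub>V\<^esub> \<pi> x = \<pi> (scale c x)"
begin

lemma map_closed [simp]: "\<pi> x \<in> carrier V"
  by (simp add: carrier_eq)

lemma is_vectorspace: "vectorspace class_ring V"
proof -
  have ag: "abelian_group V"
  proof (rule abelian_groupI)
    fix x assume "x \<in> carrier V"
    then obtain a where "x = \<pi> a" by (auto simp: carrier_eq)
    then show "\<exists>y\<in>carrier V. y \<oplus>\<^bsub>V\<^esub> x = \<zero>\<^bsub>V\<^esub>"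
      by (intro bexI[of _ "\<pi> (- a)"]) (auto simp: map_add map_zero)
  qed (auto simp: carrier_eq map_add map_zero ac_simps)
  have "module class_ring V"
    by (rule moduleI[OF class_cring.is_cring ag])
       (auto simp: carrier_eq map_add map_zero map_scale scale_left_distrib scale_right_distrib)
  then show ?thesis
    by (simp add: vectorspace_def class_field)
qed

sublocale V: vectorspace class_ring V
  by (rule is_vectorspace)

lemma map_eq_iff: "\<pi> x = \<pi> y \<longleftrightarrow> \<pi> (x - y) = \<pi> 0"
proof
  assume "\<pi> x = \<pi> y"
  then have "\<pi> x \<oplus>\<^bsub>V\<^esub> \<pi> (- y) = \<pi> y \<oplus>\<^bsub>V\<^esub> \<pi> (- y)" by simp
  then show "\<pi> (x - y) = \<pi> 0" by (simp add: map_add)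
next
  assume "\<pi> (x - y) = \<pi> 0"
  then have "\<pi> (x - y) \<oplus>\<^bsub>V\<^esub> \<pi> y = \<pi> 0 \<oplus>\<^bsub>V\<^esub> \<pi> y" by simp
  then show "\<pi> x = \<pi> y" by (simp add: map_add)
qed

lemma map_diff: "\<pi> x \<ominus>\<^bsub>V\<^esub> \<pi> y = \<pi> (x - y)"
proof -
  have "\<ominus>\<^bsub>V\<^esub> \<pi> y = \<pi> (- y)"
    by (rule V.M.minus_equality) (auto simp: map_add map_zero)
  then show ?thesis
    by (simp add: a_minus_def map_add)
qed

lemma lincomb_image:
  assumes "finite S" "inj_on \<pi> S"
  shows "V.lincomb a (\<pi> ` S) = \<pi> (\<Sum>s\<in>S. scale (a (\<pi> s)) s)"
  using assms
proof (induction S rule: finite_induct)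
  case empty
  then show ?case by (simp add: V.lincomb_def map_zero)
next
  case (insert s S)
  have "V.lincomb a (\<pi> ` insert s S) = a (\<pi> s) \<odot>\<^bsub>V\<^esub> \<pi> s \<oplus>\<^bsub>V\<^esub> V.lincomb a (\<pi> ` S)"
  proof -
    have "\<pi> ` S \<subseteq> carrier V" by auto
    then show ?thesis
      using insert V.lincomb_insert[of "\<pi> ` S" a "\<pi> s"] by auto
  qed
  with insert show ?case
    by (simp add: map_add map_scale)
qed

text \<open>The pullbacks along \<pi> of the linear functionals on \<open>V\<close>.\<close>

definition annihilating :: "('a \<Rightarrow> 'k) \<Rightarrow> bool" where
  "annihilating \<phi> \<longleftrightarrow> (\<forall>x y. \<phi> (x + y) = \<phi> x + \<phi> y) \<and> (\<forall>c x. \<phi> (scale c x) = c * \<phi> x) \<and>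
     (\<forall>x. \<pi> x = \<pi> 0 \<longrightarrow> \<phi> x = 0)"

lemma annihilating_zero: "annihilating \<phi> \<Longrightarrow> \<phi> 0 = 0"
  unfolding annihilating_def by blast

lemma annihilating_sum:
  assumes "annihilating \<phi>"
  shows "\<phi> (\<Sum>s\<in>S. f s) = (\<Sum>s\<in>S. \<phi> (f s))"
  using assms by (induction S rule: infinite_finite_induct)
    (auto simp: annihilating_zero annihilating_def)

text \<open>This is what presenting a record-based space as the image of a type-based one buys: a
  basis of \<open>J\<close> together with \<open>x\<close> is independent, and type-based linear
  algebra supplies a linear map that is 0 on the basis and 1 at \<open>x\<close>.\<close>

lemma annihilating_separates:
  assumes "subspace J" "{x. \<pi> x = \<pi> 0} \<subseteq> J" "x \<notin> J"
  shows "\<exists>\<phi>. annihilating \<phi> \<and> (\<forall>y\<in>J. \<phi> y = 0) \<and> \<phi> x = 1"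
proof -
  obtain B where B: "B \<subseteq> J" "independent B" "J \<subseteq> span B"
    using maximal_independent_subset by blast
  have "span B \<subseteq> J"
    using B(1) assms(1) span_minimal by blast
  with assms(3) have "independent (insert x B)"
    using B by (auto simp: independent_insert)
  interpret p: vector_space_pair scale "(*) :: 'k \<Rightarrow> 'k \<Rightarrow> 'k"
    by unfold_locales (auto simp: algebra_simps)
  obtain g where g: "Vector_Spaces.linear scale (*) g"
      "\<And>y. y \<in> insert x B \<Longrightarrow> g y = (if y = x then 1 else 0)"
    using p.linear_independent_extend[OF \<open>independent (insert x B)\<close>,
        where f = "\<lambda>y. if y = x then 1 else 0"] by blast
  interpret l: Vector_Spaces.linear scale "(*)" g by (rule g(1))
  have "subspace {y. g y = 0}"
    by (auto simp: subspace_def l.add l.scale l.zero)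
  moreover have "B \<subseteq> {y. g y = 0}"
    using B(1) assms(3) by (auto simp: g(2))
  ultimately have "span B \<subseteq> {y. g y = 0}"
    by (rule span_minimal[rotated])
  then have "\<forall>y\<in>J. g y = 0" using B(3) by auto
  moreover have "annihilating g"
    using calculation assms(2) unfolding annihilating_def by (auto simp: l.add l.scale)
  moreover have "g x = 1" by (simp add: g(2))
  ultimately show ?thesis by blast
qed

text \<open>A dual functional separates elements with equal image and isolates a coefficient of a
  linear relation, so it gives injectivity as well as independence. An element outside the span
  would be detected by a functional that is 0 on \<open>S\<close>.\<close>

lemma basis_image:
  assumes indep: "\<And>s. s \<in> S \<Longrightarrow> \<exists>\<phi>. annihilating \<phi> \<and> \<phi> s = 1 \<and> (\<forall>s'\<in>S. s' \<noteq> s \<longrightarrow> \<phi> s' = 0)"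
    and spanning: "\<And>\<phi> x. annihilating \<phi> \<Longrightarrow> (\<forall>s\<in>S. \<phi> s = 0) \<Longrightarrow> \<phi> x = 0"
  shows "inj_on \<pi> S \<and> V.basis (\<pi> ` S)"
proof -
  have inj: "inj_on \<pi> S"
  proof (rule inj_onI, rule ccontr)
    fix s t assume st: "s \<in> S" "t \<in> S" "\<pi> s = \<pi> t" "s \<noteq> t"
    obtain \<phi> where \<phi>: "annihilating \<phi>" "\<phi> s = 1" "\<phi> t = 0"
      using indep[OF st(1)] st by metis
    have "\<pi> (s - t) = \<pi> 0" using st(3) map_eq_iff by simp
    then have "\<phi> (s - t) = 0" using \<phi>(1) unfolding annihilating_def by blast
    moreover have "\<phi> s = \<phi> (s - t) + \<phi> t"
      using \<phi>(1) unfolding annihilating_def by (metis diff_add_cancel)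
    ultimately show False using \<phi> by simp
  qed
  have li: "V.lin_indpt (\<pi> ` S)"
  proof
    assume "V.lin_dep (\<pi> ` S)"
    then obtain A a v where A: "finite A" "A \<subseteq> \<pi> ` S" "V.lincomb a A = \<zero>\<^bsub>V\<^esub>" "v \<in> A" "a v \<noteq> 0"
      unfolding V.lin_dep_def by auto
    obtain S' where S': "S' \<subseteq> S" "A = \<pi> ` S'" "finite S'"
      using A(1,2) by (meson finite_subset_image)
    obtain s where s: "s \<in> S'" "v = \<pi> s" using A(4) S'(2) by auto
    have inj': "inj_on \<pi> S'" using inj S'(1) inj_on_subset by blast
    have z: "\<pi> (\<Sum>s\<in>S'. scale (a (\<pi> s)) s) = \<pi> 0"
      using A(3) lincomb_image[OF S'(3) inj', of a] S'(2) map_zero by simp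
    obtain \<phi> where \<phi>: "annihilating \<phi>" "\<phi> s = 1" "\<forall>s'\<in>S. s' \<noteq> s \<longrightarrow> \<phi> s' = 0"
      using indep s S'(1) by (meson subsetD)
    have "0 = \<phi> (\<Sum>s\<in>S'. scale (a (\<pi> s)) s)"
      using z \<phi>(1) unfolding annihilating_def by auto
    also have "\<dots> = (\<Sum>t\<in>S'. a (\<pi> t) * \<phi> t)"
      unfolding annihilating_sum[OF \<phi>(1)] using \<phi>(1) by (simp add: annihilating_def)
    also have "\<dots> = (\<Sum>t\<in>S'. if t = s then a (\<pi> s) else 0)"
      by (rule sum.cong) (use \<phi> S'(1) in auto)
    also have "\<dots> = a v" using S'(3) s by simp
    finally show False using A(5) by simp
  qed
  have gs: "V.span (\<pi> ` S) = carrier V"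
  proof (rule ccontr)
    let ?L = "V.span (\<pi> ` S)"
    assume ne: "?L \<noteq> carrier V"
    have sub: "\<pi> ` S \<subseteq> carrier V" by auto
    then have "?L \<subseteq> carrier V" by (rule V.span_is_subset2)
    with ne obtain x where x: "\<pi> x \<notin> ?L" using carrier_eq by auto
    have sm: "submodule class_ring ?L V" using sub by (rule V.span_is_submodule)
    interpret L: submodule class_ring ?L V by (rule sm)
    have "subspace {x. \<pi> x \<in> ?L}"
    proof (rule subspaceI)
      show "0 \<in> {x. \<pi> x \<in> ?L}" using L.zero_closed by (simp add: map_zero)
    next
      fix a b assume "a \<in> {x. \<pi> x \<in> ?L}" "b \<in> {x. \<pi> x \<in> ?L}"
      then show "a + b \<in> {x. \<pi> x \<in> ?L}" using L.m_closed[of "\<pi> a" "\<pi> b"] by (simp add: map_add)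
    next
      fix c a assume "a \<in> {x. \<pi> x \<in> ?L}"
      then show "scale c a \<in> {x. \<pi> x \<in> ?L}" using L.smult_closed[of c "\<pi> a"] by (simp add: map_scale)
    qed
    moreover have "{x. \<pi> x = \<pi> 0} \<subseteq> {x. \<pi> x \<in> ?L}"
      using L.zero_closed by (auto simp: map_zero)
    ultimately obtain \<phi> where \<phi>: "annihilating \<phi>" "\<forall>y. \<pi> y \<in> ?L \<longrightarrow> \<phi> y = 0" "\<phi> x = 1"
      using annihilating_separates[of "{x. \<pi> x \<in> ?L}" x] x by auto
    have "\<forall>s\<in>S. \<phi> s = 0" using \<phi>(2) V.in_own_span[OF sub] by auto
    from spanning[OF \<phi>(1) this, of x] \<phi>(3) show False by simp
  qed
  show ?thesis
    unfolding V.basis_def by (intro conjI inj li gs image_subsetI map_closed)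
qed

text \<open>Serves for the algebra as a quotient of the free algebra and again for its HH_0; only
  the linear fields of \<open>Q\<close> are prescribed, so it fits both kinds of record.\<close>

lemma linear_surjection_quotient:
  assumes N: "submodule class_ring N V"
    and Q: "carrier Q = a_rcosets\<^bsub>V\<^esub> N" "add Q = set_add V" "zero Q = N" "smult Q = quot_smult V N"
  shows "linear_surjection scale Q (\<lambda>x. N +>\<^bsub>V\<^esub> \<pi> x)"
    and "\<And>x. N +>\<^bsub>V\<^esub> \<pi> x = N +>\<^bsub>V\<^esub> \<pi> 0 \<longleftrightarrow> \<pi> x \<in> N"
proof -
  interpret N: submodule class_ring N V by (rule N)
  have "subgroup N (add_monoid V)"
  proof
    fix x assume x: "x \<in> N"
    then obtain a where a: "x = \<pi> a" using N.subset carrier_eq by auto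
    have "\<pi> (scale (-1) a) \<in> N" using N.smult_closed[of "-1" x] x a by (simp add: map_scale)
    moreover have "\<pi> (scale (-1) a) = \<ominus>\<^bsub>V\<^esub> x"
      using map_diff[of 0 a] a by (simp add: map_zero[symmetric] a_minus_def)
    ultimately show "inv\<^bsub>add_monoid V\<^esub> x \<in> N" by (simp add: a_inv_def)
  qed (use N.subset N.m_closed N.zero_closed in auto)
  then interpret sg: abelian_subgroup N V
    using abelian_subgroupI3 additive_subgroup.intro V.M.abelian_group_axioms by blast
  have zero: "N +>\<^bsub>V\<^esub> \<pi> 0 = N"
    using V.M.a_coset_add_zero[of N] N.subset by (simp add: map_zero)
  have smult: "quot_smult V N c (N +>\<^bsub>V\<^esub> \<pi> x) = N +>\<^bsub>V\<^esub> \<pi> (scale c x)" for c x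
  proof -
    have "N +>\<^bsub>V\<^esub> (c \<odot>\<^bsub>V\<^esub> y) = N +>\<^bsub>V\<^esub> \<pi> (scale c x)" if y: "y \<in> N +>\<^bsub>V\<^esub> \<pi> x" for y
    proof -
      obtain n where n: "n \<in> N" "y = n \<oplus>\<^bsub>V\<^esub> \<pi> x" using y unfolding a_r_coset_def' by blast
      obtain m where m: "n = \<pi> m" using n N.subset carrier_eq by auto
      have "c \<odot>\<^bsub>V\<^esub> y = c \<odot>\<^bsub>V\<^esub> n \<oplus>\<^bsub>V\<^esub> \<pi> (scale c x)"
        using n m by (simp add: map_add map_scale scale_right_distrib)
      moreover have "c \<odot>\<^bsub>V\<^esub> n \<in> N" using N.smult_closed n by simp
      ultimately have "c \<odot>\<^bsub>V\<^esub> y \<in> N +>\<^bsub>V\<^esub> \<pi> (scale c x)" by (auto simp: a_r_coset_def')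
      then show ?thesis using sg.a_repr_independence'[OF _ map_closed] by blast
    qed
    moreover have "\<pi> x \<in> N +>\<^bsub>V\<^esub> \<pi> x" by (simp add: sg.a_rcos_self)
    ultimately show ?thesis unfolding quot_smult_def by blast
  qed
  show "linear_surjection scale Q (\<lambda>x. N +>\<^bsub>V\<^esub> \<pi> x)"
    by unfold_locales
      (auto simp: Q A_RCOSETS_def' carrier_eq sg.a_rcos_sum map_add zero smult)
  show "N +>\<^bsub>V\<^esub> \<pi> x = N +>\<^bsub>V\<^esub> \<pi> 0 \<longleftrightarrow> \<pi> x \<in> N" for x
    unfolding zero using sg.a_rcos_self[of "\<pi> x"] sg.a_rcos_const[of "\<pi> x"] by auto
qed

end

section \<open>Trace functionals and $HH_0$\<close>

text \<open>Scalars become central elements of the monoid algebra, so module laws reduce to ring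
  laws and a two-sided ideal is automatically a subspace.\<close>

lemma free_smult_conv_mult: "free_smult c x = Poly_Mapping.single 0 c * x"
  by (simp add: free_smult_def mult_map_scale_conv_mult)

lemma free_alg_induct [case_names single add]:
  assumes single: "\<And>w c. P (Poly_Mapping.single w c)"
    and add: "\<And>x y. P x \<Longrightarrow> P y \<Longrightarrow> P (x + y)"
  shows "P (x :: word \<Rightarrow>\<^sub>0 'k::comm_monoid_add)"
proof -
  have "P (\<Sum>k\<in>A. Poly_Mapping.single k (f k))" for A and f :: "word \<Rightarrow> 'k"
    by (induction A rule: infinite_finite_induct)
       (auto intro: add single simp: single[of 0 0, simplified])
  moreover have "x = (\<Sum>k\<in>Poly_Mapping.keys x. Poly_Mapping.single k (Poly_Mapping.lookup x k))"
    by (rule poly_mapping_eqI) (simp add: lookup_sum lookup_single when_def in_keys_iff)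
  ultimately show ?thesis
    by metis
qed

lemma single_zero_central: "x * Poly_Mapping.single 0 c = Poly_Mapping.single 0 c * (x :: 'k::field free_alg)"
  by (induction x rule: free_alg_induct) (auto simp: mult_single algebra_simps)

lemma vector_space_free_smult: "vector_space (free_smult :: 'k::field \<Rightarrow> _)"
  by unfold_locales
    (auto simp: free_smult_conv_mult algebra_simps single_add mult_single mult.assoc[symmetric])

lemma mult_free_smult_left: "free_smult c x * y = free_smult c (x * y)"
  by (simp add: free_smult_conv_mult mult.assoc)

lemma mult_free_smult_right: "x * free_smult c y = free_smult c (x * y)"
  by (simp add: free_smult_conv_mult mult.assoc[symmetric] single_zero_central)

lemma linear_surjection_free_algebra:
  "linear_surjection free_smult (free_algebra :: ('k::field, 'k free_alg) module) (\<lambda>x. x)"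
  by (auto simp: linear_surjection_def linear_surjection_axioms_def vector_space_free_smult
      free_algebra_def)

lemma ring_free_algebra: "ring (free_algebra :: ('k::field, 'k free_alg) module)"
proof -
  interpret f: linear_surjection free_smult "free_algebra :: ('k, 'k free_alg) module" "\<lambda>x. x"
    by (rule linear_surjection_free_algebra)
  show ?thesis
    by (intro ringI f.V.M.abelian_group_axioms monoidI)
      (auto simp: free_algebra_def algebra_simps)
qed

lemma submodule_ideal:
  assumes "ideal I (free_algebra :: ('k::field, 'k free_alg) module)"
  shows "submodule class_ring I (free_algebra :: ('k, 'k free_alg) module)"
proof -
  interpret f: linear_surjection free_smult "free_algebra :: ('k, 'k free_alg) module" "\<lambda>x. x"
    by (rule linear_surjection_free_algebra)
  interpret ideal I "free_algebra :: ('k, 'k free_alg) module" by (rule assms)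
  show ?thesis
  proof
    fix c :: 'k and x assume "x \<in> I"
    then have "Poly_Mapping.single 0 c \<otimes>\<^bsub>free_algebra\<^esub> x \<in> I"
      by (rule I_l_closed) (simp add: free_algebra_def)
    then show "c \<odot>\<^bsub>free_algebra\<^esub> x \<in> I"
      by (simp add: free_algebra_def free_smult_conv_mult)
  qed (use a_subset a_closed zero_closed in auto)
qed

definition trace_functional :: "'k::field free_alg set \<Rightarrow> ('k free_alg \<Rightarrow> 'k) \<Rightarrow> bool" where
  "trace_functional I \<phi> \<longleftrightarrow> (\<forall>x y. \<phi> (x + y) = \<phi> x + \<phi> y) \<and> (\<forall>c x. \<phi> (free_smult c x) = c * \<phi> x) \<and>
     (\<forall>x\<in>I. \<phi> x = 0) \<and> (\<forall>x y. \<phi> (x * y) = \<phi> (y * x))"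

locale free_alg_quotient =
  fixes I :: "'k::field free_alg set" and A :: "('k, 'k free_alg set) module" (structure)
  assumes ideal: "ideal I free_algebra"
    and A_def: "A = quot_algebra free_algebra I"
begin

abbreviation coset :: "'k free_alg \<Rightarrow> 'k free_alg set" where
  "coset x \<equiv> I +>\<^bsub>free_algebra\<^esub> x"

sublocale F: linear_surjection free_smult "free_algebra :: ('k, 'k free_alg) module" "\<lambda>x. x"
  by (rule linear_surjection_free_algebra)

sublocale Q: linear_surjection free_smult A coset
  by (rule F.linear_surjection_quotient(1)[OF submodule_ideal[OF ideal]])
    (simp_all add: A_def quot_algebra_def)

lemma coset_eq_coset_zero_iff: "coset x = coset 0 \<longleftrightarrow> x \<in> I"
  by (rule F.linear_surjection_quotient(2)[OF submodule_ideal[OF ideal], of A])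
    (simp_all add: A_def quot_algebra_def)

lemma coset_mult: "coset x \<otimes> coset y = coset (x * y)"
  using ideal.rcoset_mult_add[OF ideal, of x y]
  by (simp add: A_def quot_algebra_def) (simp add: free_algebra_def)

lemma coset_one: "\<one> = coset 1"
  by (simp add: A_def quot_algebra_def) (simp add: free_algebra_def)

lemma coset_pow: "coset x [^] (n::nat) = coset (x ^ n)"
  by (induction n) (auto simp: nat_pow_def coset_one coset_mult power_Suc2 simp del: power_Suc)

definition commutators :: "'k free_alg set set" where
  "commutators = {coset (x * y - y * x) | x y. True}"

lemma commutator_space_eq: "commutator_space A = Q.V.span commutators"
proof -
  have "{a \<otimes> b \<ominus> b \<otimes> a | a b. a \<in> carrier A \<and> b \<in> carrier A} = commutators"
    (is "?L = _")
  proof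
    show "?L \<subseteq> commutators"
      unfolding commutators_def Q.carrier_eq by (auto simp: coset_mult Q.map_diff) blast
    have "coset (x * y - y * x) \<in> ?L" for x y
      by (rule CollectI, rule exI[of _ "coset x"], rule exI[of _ "coset y"])
        (simp add: coset_mult Q.map_diff)
    then show "commutators \<subseteq> ?L"
      unfolding commutators_def by blast
  qed
  then show ?thesis
    by (simp add: commutator_space_def)
qed

lemma submodule_commutator_space: "submodule class_ring (commutator_space A) A"
  unfolding commutator_space_eq by (rule Q.V.span_is_submodule) (auto simp: commutators_def)

sublocale H: linear_surjection free_smult "HH0 A" "\<lambda>x. HH0_class A (coset x)"
  unfolding HH0_class_def
  by (rule Q.linear_surjection_quotient(1)[OF submodule_commutator_space])
    (simp_all add: HH0_def quot_space_def)

lemma HH0_class_coset_eq_zero_iff: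
  "HH0_class A (coset x) = HH0_class A (coset 0) \<longleftrightarrow> coset x \<in> commutator_space A"
  unfolding HH0_class_def
  by (rule Q.linear_surjection_quotient(2)[OF submodule_commutator_space, of "HH0 A"])
    (simp_all add: HH0_def quot_space_def)

lemma annihilating_iff_trace_functional: "H.annihilating \<phi> \<longleftrightarrow> trace_functional I \<phi>"
proof
  assume \<phi>: "H.annihilating \<phi>"
  have kernel: "\<phi> x = 0" if "coset x \<in> commutator_space A" for x
    using \<phi> that by (simp add: H.annihilating_def HH0_class_coset_eq_zero_iff)
  have "coset (x * y - y * x) \<in> commutator_space A" for x y
    unfolding commutator_space_eq
    by (rule subsetD[OF Q.V.in_own_span]) (auto simp: commutators_def)
  then have "\<phi> (x * y - y * x) = 0" for x y
    using kernel by blast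
  moreover have "\<phi> (x * y - y * x) + \<phi> (y * x) = \<phi> (x * y)" for x y
    using \<phi> unfolding H.annihilating_def by (metis diff_add_cancel)
  ultimately have "\<phi> (x * y) = \<phi> (y * x)" for x y
    by (metis add_0)
  moreover have "\<phi> x = 0" if "x \<in> I" for x
    using \<phi> coset_eq_coset_zero_iff[of x] that by (simp add: H.annihilating_def)
  ultimately show "trace_functional I \<phi>"
    using \<phi> by (simp add: H.annihilating_def trace_functional_def)
next
  assume \<phi>: "trace_functional I \<phi>"
  then have add: "\<phi> (x + y) = \<phi> x + \<phi> y" and scale: "\<phi> (free_smult c x) = c * \<phi> x"
    and ideal0: "x \<in> I \<Longrightarrow> \<phi> x = 0" and comm: "\<phi> (x * y) = \<phi> (y * x)" for x y c
    by (auto simp: trace_functional_def)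
  have zero: "\<phi> 0 = 0"
    using scale[of 0 0] by (simp add: free_smult_conv_mult)
  have diff: "\<phi> (x - y) = \<phi> x - \<phi> y" for x y
    using add[of "x - y" y] by simp
  \<comment> \<open>The image of the kernel of \<phi> is a subspace that contains all commutators,
    hence their span; \<open>N_iff\<close> rests on \<phi> vanishing on \<open>I\<close>.\<close>
  define N where "N = coset ` {x. \<phi> x = 0}"
  have N_iff: "coset x \<in> N \<longleftrightarrow> \<phi> x = 0" for x
  proof
    assume "coset x \<in> N"
    then obtain y where y: "coset x = coset y" "\<phi> y = 0" by (auto simp: N_def)
    then have "x - y \<in> I" using Q.map_eq_iff coset_eq_coset_zero_iff by simp
    with y show "\<phi> x = 0" using ideal0 diff by fastforce
  qed (auto simp: N_def)
  have "submodule class_ring N A"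
  proof
    fix v w assume "v \<in> N" "w \<in> N"
    then show "v \<oplus> w \<in> N"
      unfolding N_def by (auto simp: Q.map_add add)
  next
    fix c v assume "v \<in> N"
    then show "c \<odot> v \<in> N"
      unfolding N_def by (auto simp: Q.map_scale scale)
  qed (auto simp: Q.map_zero N_iff zero, auto simp: N_def)
  moreover have "commutators \<subseteq> N"
    by (auto simp: commutators_def N_iff diff comm)
  ultimately have "commutator_space A \<subseteq> N"
    unfolding commutator_space_eq by (rule Q.V.span_is_subset[rotated])
  then show "H.annihilating \<phi>"
    unfolding H.annihilating_def HH0_class_coset_eq_zero_iff
    using add scale N_iff by auto
qed

lemma classes_form_basis_HH0I:
  assumes indep: "\<And>t. t \<in> T \<Longrightarrow>
      \<exists>\<phi>. trace_functional I \<phi> \<and> \<phi> (e t) = 1 \<and> (\<forall>s\<in>T. s \<noteq> t \<longrightarrow> \<phi> (e s) = 0)"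
    and spanning: "\<And>\<phi> x. trace_functional I \<phi> \<Longrightarrow> (\<forall>t\<in>T. \<phi> (e t) = 0) \<Longrightarrow> \<phi> x = 0"
  shows "classes_form_basis_HH0 A ((\<lambda>t. coset (e t)) ` T)"
proof -
  have "inj_on (\<lambda>x. HH0_class A (coset x)) (e ` T) \<and>
      H.V.basis ((\<lambda>x. HH0_class A (coset x)) ` e ` T)"
  proof (rule H.basis_image)
    fix s assume "s \<in> e ` T"
    then obtain t where t: "t \<in> T" "s = e t" by auto
    obtain \<phi> where "trace_functional I \<phi>" "\<phi> (e t) = 1" "\<forall>s\<in>T. s \<noteq> t \<longrightarrow> \<phi> (e s) = 0"
      using indep[OF t(1)] by blast
    then show "\<exists>\<phi>. H.annihilating \<phi> \<and> \<phi> s = 1 \<and> (\<forall>s'\<in>e ` T. s' \<noteq> s \<longrightarrow> \<phi> s' = 0)"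
      unfolding annihilating_iff_trace_functional t(2) by (intro exI[of _ \<phi>]) auto
  next
    fix \<phi> x assume "H.annihilating \<phi>" "\<forall>s\<in>e ` T. \<phi> s = 0"
    then show "\<phi> x = 0"
      using spanning unfolding annihilating_iff_trace_functional by blast
  qed
  then have "inj_on (HH0_class A \<circ> coset) (e ` T)" "H.V.basis (HH0_class A ` coset ` e ` T)"
    by (simp_all add: comp_def image_image)
  then show ?thesis
    unfolding classes_form_basis_HH0_def
    by (metis inj_on_imageI image_image)
qed

end

section \<open>Functionals from functions on triples\<close>

text \<open>
  In \<open>A\<close> one has \<open>w = r1 (d u - r2 u d)\<close>, \<open>d w = r1 w d\<close> and \<open>w u = r1 u w\<close>, so with \<open>q = r1\<close> and
  \<open>p = r2\<close> the coefficient below satisfies \<open>d u\<^sup>i = p\<^sup>i u\<^sup>i d + c\<^sub>i u\<^sup>i\<^sup>-\<^sup>1 w\<close>.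
\<close>

fun cross_coeff :: "'k::field \<Rightarrow> 'k \<Rightarrow> nat \<Rightarrow> 'k" where
  "cross_coeff q p 0 = 0"
| "cross_coeff q p (Suc k) = p * cross_coeff q p k + q ^ k / q"

text \<open>c_k is 1/q times the sum of p^a q^b over a + b = k - 1. The sum is symmetric in p and q,
  so the recursion may peel off q instead of p.\<close>

lemma cross_coeff_Suc': "cross_coeff q p (Suc k) = q * cross_coeff q p k + p ^ k / q"
proof (induction k)
  case (Suc k)
  have "cross_coeff q p (Suc (Suc k)) = p * (q * cross_coeff q p k + p ^ k / q) + q ^ Suc k / q"
    unfolding Suc[symmetric] by simp
  also have "\<dots> = q * (p * cross_coeff q p k + q ^ k / q) + p ^ Suc k / q"
    by (simp add: divide_inverse algebra_simps)
  finally show ?case by simp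
qed simp

text \<open>
  A function \<open>F\<close> on triples stands for the functional on \<open>A\<close> that maps \<open>u\<^sup>i w\<^sup>j d\<^sup>k\<close> to \<open>F i j k\<close>;
  the two operators below are the transposes of left and right multiplication by a generator.
\<close>

fun lmul :: "'k::field \<Rightarrow> 'k \<Rightarrow> gen \<Rightarrow> (nat \<Rightarrow> nat \<Rightarrow> nat \<Rightarrow> 'k) \<Rightarrow> nat \<Rightarrow> nat \<Rightarrow> nat \<Rightarrow> 'k" where
  "lmul q p U F = (\<lambda>i j k. F (Suc i) j k)"
| "lmul q p D F = (\<lambda>i j k. p ^ i * q ^ j * F i j (Suc k) + cross_coeff q p i * F (i - 1) (Suc j) k)"

fun rmul :: "'k::field \<Rightarrow> 'k \<Rightarrow> gen \<Rightarrow> (nat \<Rightarrow> nat \<Rightarrow> nat \<Rightarrow> 'k) \<Rightarrow> nat \<Rightarrow> nat \<Rightarrow> nat \<Rightarrow> 'k" where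
  "rmul q p U F = (\<lambda>i j k. q ^ j * p ^ k * F (Suc i) j k + cross_coeff q p k * F i (Suc j) (k - 1))"
| "rmul q p D F = (\<lambda>i j k. F i j (Suc k))"

text \<open>Only generators are tested; \<open>functional_of_commute\<close> extends the trace
  property to arbitrary elements.\<close>

definition tracial :: "'k::field \<Rightarrow> 'k \<Rightarrow> (nat \<Rightarrow> nat \<Rightarrow> nat \<Rightarrow> 'k) \<Rightarrow> bool" where
  "tracial q p F \<longleftrightarrow> (\<forall>x. lmul q p x F = rmul q p x F)"

text \<open>This is the transpose of (x m) y = x (m y). The case x = D, y = U has the content, since
  there both operators create a w.\<close>

lemma lmul_rmul_commute: "lmul q p x (rmul q p y F) = rmul q p y (lmul q p x F)"
proof (cases x; cases y)
  assume [simp]: "x = D" "y = U"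
  show ?thesis
  proof (intro ext)
    fix i j k
    \<comment> \<open>Both sides equal q p^i c_k + q p^k c_i + p^(i+k) / q, which is symmetric in i
      and k.\<close>
    have eq: "p ^ i * cross_coeff q p (Suc k) + q * p ^ k * cross_coeff q p i =
        p ^ k * cross_coeff q p (Suc i) + q * p ^ i * cross_coeff q p k"
      unfolding cross_coeff_Suc' by (simp add: algebra_simps)
    define F1 F2 where "F1 = F i (Suc j) k" and "F2 = q ^ j * F1"
    have "p ^ i * q ^ j * (cross_coeff q p (Suc k) * F1) + cross_coeff q p i * (q ^ Suc j * p ^ k * F1) =
        F2 * (p ^ i * cross_coeff q p (Suc k) + q * p ^ k * cross_coeff q p i)"
      by (simp add: F2_def algebra_simps)
    also have "\<dots> = q ^ j * p ^ k * (cross_coeff q p (Suc i) * F1) + cross_coeff q p k * (p ^ i * q ^ Suc j * F1)"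
      unfolding eq by (simp add: F2_def algebra_simps)
    finally have "p ^ i * q ^ j * (cross_coeff q p (Suc k) * F1) + cross_coeff q p i * (q ^ Suc j * p ^ k * F1) =
      q ^ j * p ^ k * (cross_coeff q p (Suc i) * F1) + cross_coeff q p k * (p ^ i * q ^ Suc j * F1)" .
    then show "lmul q p x (rmul q p y F) i j k = rmul q p y (lmul q p x F) i j k"
      unfolding F1_def by (cases i; cases k) (simp_all add: algebra_simps del: cross_coeff.simps(2))
  qed
qed auto

lemma lmul_relations:
  assumes "q \<noteq> 0"
  shows "lmul q p U (lmul q p D (lmul q p D F)) i j k =
      (p + q) * lmul q p D (lmul q p U (lmul q p D F)) i j k - p * q * lmul q p D (lmul q p D (lmul q p U F)) i j k"
    and "lmul q p U (lmul q p U (lmul q p D F)) i j k =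
      (p + q) * lmul q p U (lmul q p D (lmul q p U F)) i j k - p * q * lmul q p D (lmul q p U (lmul q p U F)) i j k"
proof -
  have c: "q * cross_coeff q p (Suc i) = q * p * cross_coeff q p i + q ^ i" for i
    using assms by (simp add: algebra_simps)
  have c': "q ^ i = q * cross_coeff q p (Suc i) - q * p * cross_coeff q p i" for i
    using c[of i] by (simp add: algebra_simps)
  \<comment> \<open>\<open>cross_coeff\<close> satisfies the recurrence with characteristic
    polynomial t^2 - (p + q) t + p q, the polynomial behind the down-up relations; this form
    contains no division.\<close>
  have c2: "cross_coeff q p (Suc (Suc i)) = p * cross_coeff q p (Suc i) + (q * cross_coeff q p (Suc i) - q * p * cross_coeff q p i)" for i
    using assms c'[of i] by simp
  show "lmul q p U (lmul q p U (lmul q p D F)) i j k =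
      (p + q) * lmul q p U (lmul q p D (lmul q p U F)) i j k - p * q * lmul q p D (lmul q p U (lmul q p U F)) i j k"
    unfolding lmul.simps c2 by (cases i) (simp_all add: algebra_simps del: cross_coeff.simps(2))
  show "lmul q p U (lmul q p D (lmul q p D F)) i j k =
      (p + q) * lmul q p D (lmul q p U (lmul q p D F)) i j k - p * q * lmul q p D (lmul q p D (lmul q p U F)) i j k"
  proof (cases i)
    case 0
    then show ?thesis using assms by (simp add: field_simps)
  next
    case (Suc m)
    show ?thesis unfolding Suc lmul.simps c2 by (cases m) (simp_all add: algebra_simps del: cross_coeff.simps(2))
  qed
qed

text \<open>
  \<open>act q p x F\<close> is the functional \<open>y \<mapsto> F (x y)\<close>, so the action is on the right: \<open>act_mult\<close>.
\<close>

fun act_word :: "'k::field \<Rightarrow> 'k \<Rightarrow> word \<Rightarrow> (nat \<Rightarrow> nat \<Rightarrow> nat \<Rightarrow> 'k) \<Rightarrow> nat \<Rightarrow> nat \<Rightarrow> nat \<Rightarrow> 'k" where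
  "act_word q p (Word xs) F = fold (lmul q p) xs F"

definition act :: "'k::field \<Rightarrow> 'k \<Rightarrow> 'k free_alg \<Rightarrow> (nat \<Rightarrow> nat \<Rightarrow> nat \<Rightarrow> 'k) \<Rightarrow> nat \<Rightarrow> nat \<Rightarrow> nat \<Rightarrow> 'k" where
  "act q p x F = (\<lambda>i j k. \<Sum>w\<in>Poly_Mapping.keys x. Poly_Mapping.lookup x w * act_word q p w F i j k)"

lemma act_add: "act q p (x + y) F = (\<lambda>i j k. act q p x F i j k + act q p y F i j k)"
  unfolding act_def by (intro ext setsum_keys_plus_distrib) (auto simp: algebra_simps)

lemma act_single: "act q p (Poly_Mapping.single w c) F = (\<lambda>i j k. c * act_word q p w F i j k)"
  by (auto simp: act_def)

lemma act_word_add: "act_word q p (v + w) F = act_word q p w (act_word q p v F)"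
  by (cases v; cases w) simp

lemma lmul_linear:
  "lmul q p x (\<lambda>i j k. F i j k + G i j k) = (\<lambda>i j k. lmul q p x F i j k + lmul q p x G i j k)"
  "lmul q p x (\<lambda>i j k. c * F i j k) = (\<lambda>i j k. c * lmul q p x F i j k)"
  by (cases x; auto simp: algebra_simps)+

lemma fold_lmul_linear:
  "fold (lmul q p) xs (\<lambda>i j k. F i j k + G i j k) =
    (\<lambda>i j k. fold (lmul q p) xs F i j k + fold (lmul q p) xs G i j k)"
  "fold (lmul q p) xs (\<lambda>i j k. c * F i j k) = (\<lambda>i j k. c * fold (lmul q p) xs F i j k)"
  by (induction xs arbitrary: F G) (auto simp: lmul_linear)

lemma act_word_linear:
  "act_word q p w (\<lambda>i j k. F i j k + G i j k) = (\<lambda>i j k. act_word q p w F i j k + act_word q p w G i j k)"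
  "act_word q p w (\<lambda>i j k. c * F i j k) = (\<lambda>i j k. c * act_word q p w F i j k)"
  by (cases w; simp add: fold_lmul_linear)+

lemma act_mult: "act q p (x * y) F = act q p y (act q p x F)"
proof (induction y rule: free_alg_induct)
  case (single w c)
  show ?case
    by (induction x rule: free_alg_induct)
      (auto simp: mult_single act_single act_add act_word_add act_word_linear algebra_simps)
qed (simp add: act_add algebra_simps)

lemma act_zero: "act q p 0 F = (\<lambda>i j k. 0)"
  by (simp add: act_def)

lemma act_one: "act q p 1 F = F"
  unfolding single_one[symmetric] act_single by (simp add: zero_word_def)

lemma act_free_smult: "act q p (free_smult c x) F = (\<lambda>i j k. c * act q p x F i j k)"
  by (induction x rule: free_alg_induct)
    (auto simp: free_smult_conv_mult mult_single act_single act_add algebra_simps)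

lemma act_uminus: "act q p (- x) F = (\<lambda>i j k. - act q p x F i j k)"
  using act_free_smult[of q p "-1" x F]
  by (simp add: free_smult_conv_mult single_uminus)

lemma act_diff: "act q p (x - y) F = (\<lambda>i j k. act q p x F i j k - act q p y F i j k)"
  using act_add[of q p x "- y" F] by (simp add: act_uminus)

lemma act_free_gen: "act q p (free_gen x) F = lmul q p x F"
  by (simp add: free_gen_def act_single)

lemma act_zero_right: "act q p x (\<lambda>i j k. 0) = (\<lambda>i j k. 0)"
  \<comment> \<open>The equation 0 * x = 0, read through \<open>act_mult\<close>, says that x maps
    the zero function to itself.\<close>
  using act_mult[of q p 0 x undefined] by (simp add: act_zero)

lemma act_rmul_commute: "act q p x (rmul q p y F) = rmul q p y (act q p x F)"
proof (induction x rule: free_alg_induct)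
  case (single w c)
  have "fold (lmul q p) xs (rmul q p y F) = rmul q p y (fold (lmul q p) xs F)" for xs
    by (induction xs arbitrary: F) (auto simp: lmul_rmul_commute)
  then have "act_word q p w (rmul q p y F) = rmul q p y (act_word q p w F)"
    by (cases w) simp
  then show ?case
    by (cases y) (auto simp: act_single algebra_simps)
next
  case (add x x')
  then show ?case
    by (cases y) (auto simp: act_add algebra_simps)
qed

text \<open>Evaluates the functional y \<mapsto> F (x y) at the monomial 1, whose index is (0, 0,
  0).\<close>

definition functional_of :: "'k::field \<Rightarrow> 'k \<Rightarrow> (nat \<Rightarrow> nat \<Rightarrow> nat \<Rightarrow> 'k) \<Rightarrow> 'k free_alg \<Rightarrow> 'k" where
  "functional_of q p F x = act q p x F 0 0 0"

lemma functional_of_commute_gen: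
  assumes "tracial q p F"
  shows "functional_of q p F (free_gen x * y) = functional_of q p F (y * free_gen x)"
proof -
  have "functional_of q p F (free_gen x * y) = act q p y (rmul q p x F) 0 0 0"
    using assms by (simp add: functional_of_def act_mult act_free_gen tracial_def)
  also have "\<dots> = rmul q p x (act q p y F) 0 0 0"
    by (simp add: act_rmul_commute)
  \<comment> \<open>At (0, 0, 0) the two operators agree on every function, because x 1 = 1
    x.\<close>
  also have "\<dots> = lmul q p x (act q p y F) 0 0 0"
    by (cases x) auto
  finally show ?thesis
    by (simp add: functional_of_def act_mult act_free_gen)
qed

lemma single_Word_Cons:
  "Poly_Mapping.single (Word (x # xs)) c = free_gen x * Poly_Mapping.single (Word xs) c"
  by (simp add: free_gen_def mult_single)

lemma functional_of_commute:
  assumes "tracial q p F"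
  shows "functional_of q p F (x * y) = functional_of q p F (y * x)"
proof (induction x arbitrary: y rule: free_alg_induct)
  case (single w c)
  obtain xs where [simp]: "w = Word xs" by (cases w)
  have "functional_of q p F (Poly_Mapping.single (Word xs) c * y) =
      functional_of q p F (y * Poly_Mapping.single (Word xs) c)"
  proof (induction xs arbitrary: y)
    case Nil
    then show ?case using single_zero_central[of y c] by (simp add: zero_word_def)
  next
    case (Cons x xs)
    have "functional_of q p F (Poly_Mapping.single (Word (x # xs)) c * y) =
        functional_of q p F (Poly_Mapping.single (Word xs) c * (y * free_gen x))"
      using functional_of_commute_gen[OF assms, of x "Poly_Mapping.single (Word xs) c * y"]
      by (simp add: single_Word_Cons mult.assoc)
    also have "\<dots> = functional_of q p F (y * Poly_Mapping.single (Word (x # xs)) c)"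
      unfolding Cons by (simp add: single_Word_Cons mult.assoc)
    finally show ?case .
  qed
  then show ?case by simp
next
  case (add x x')
  then show ?case by (simp add: functional_of_def algebra_simps act_add)
qed

lemma ideal_annihilators:
  "ideal {x. \<forall>F. act q p x F = (\<lambda>i j k. 0)} (free_algebra :: ('k::field, 'k free_alg) module)"
proof -
  interpret ring "free_algebra :: ('k, 'k free_alg) module" by (rule ring_free_algebra)
  have inv: "inv\<^bsub>add_monoid free_algebra\<^esub> x = - x" for x :: "'k free_alg"
    using minus_equality[of "- x" x] by (simp add: a_inv_def free_algebra_def)
  show ?thesis
    by (intro idealI ring_free_algebra subgroup.intro)
      (simp_all add: inv, auto simp: free_algebra_def act_add act_zero act_uminus act_mult act_zero_right)
qed

section \<open>Functionals on a down-up algebra\<close>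

definition free_w :: "'k::field \<Rightarrow> 'k \<Rightarrow> 'k free_alg" where
  "free_w q p = free_smult (- (p * q)) (free_gen U * free_gen D) + free_smult q (free_gen D * free_gen U)"

definition pbw :: "'k::field \<Rightarrow> 'k \<Rightarrow> nat \<Rightarrow> nat \<Rightarrow> nat \<Rightarrow> 'k free_alg" where
  "pbw q p i j k = free_gen U ^ i * free_w q p ^ j * free_gen D ^ k"

text \<open>Seen from (0, 0, 0), d^k shifts only the third index, then w^j, acting at first index 0,
  only the second, and u^i the first, so no power of p or q survives. Thus arbitrary values on the
  monomials are realised by a functional.\<close>

lemma functional_of_pbw:
  assumes "q \<noteq> 0"
  shows "functional_of q p F (pbw q p i j k) = F i j k"
proof -
  have u: "act q p (free_gen U ^ i) F = (\<lambda>a b c. F (a + i) b c)" for F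
    by (induction i arbitrary: F) (simp_all add: act_one act_mult act_free_gen)
  have w: "act q p (free_w q p) F 0 b c = F 0 (Suc b) c" for F b c
    using assms
    by (simp add: free_w_def act_add act_free_smult act_mult act_free_gen algebra_simps)
  have wj: "act q p (free_w q p ^ j) F 0 b c = F 0 (b + j) c" for F b c
    by (induction j arbitrary: F b) (simp_all add: act_one act_mult w)
  have d: "act q p (free_gen D ^ k) F 0 0 c = F 0 0 (c + k)" for F c
    by (induction k arbitrary: F c) (simp_all add: act_one act_mult act_free_gen)
  show ?thesis
    by (simp add: functional_of_def pbw_def act_mult u wj d)
qed

lemma down_up_ideal_subset_annihilators:
  assumes "q \<noteq> 0"
  shows "down_up_ideal (p + q) (- (p * q)) \<subseteq> {x. \<forall>F. act q p x F = (\<lambda>i j k. 0)}"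
proof -
  interpret ring "free_algebra :: ('a, 'a free_alg) module" by (rule ring_free_algebra)
  show ?thesis
    unfolding down_up_ideal_def Let_def
    by (rule genideal_minimal[OF ideal_annihilators], intro subsetI CollectI allI ext)
      (elim insertE emptyE; simp only: act_diff act_add act_free_smult act_mult act_free_gen
        lmul_relations(1)[OF assms] lmul_relations(2)[OF assms]; simp add: algebra_simps)
qed

lemma trace_functional_functional_of:
  assumes "q \<noteq> 0" "tracial q p F"
  shows "trace_functional (down_up_ideal (p + q) (- (p * q))) (functional_of q p F)"
  using down_up_ideal_subset_annihilators[OF assms(1), of p] functional_of_commute[OF assms(2)]
  by (auto simp: trace_functional_def functional_of_def act_add act_free_smult)

lemma ideal_down_up_ideal: "ideal (down_up_ideal \<alpha> \<beta>) (free_algebra :: ('k::field, 'k free_alg) module)"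
proof -
  interpret ring "free_algebra :: ('k, 'k free_alg) module" by (rule ring_free_algebra)
  show ?thesis
    unfolding down_up_ideal_def Let_def by (rule genideal_ideal) (simp add: free_algebra_def)
qed

lemma down_up_relations:
  "free_gen D * free_gen D * free_gen U - (free_smult \<alpha> (free_gen D * free_gen U * free_gen D) +
     free_smult \<beta> (free_gen U * free_gen D * free_gen D)) \<in> down_up_ideal \<alpha> (\<beta> :: 'k::field)" (is ?A)
  "free_gen D * free_gen U * free_gen U - (free_smult \<alpha> (free_gen U * free_gen D * free_gen U) +
     free_smult \<beta> (free_gen U * free_gen U * free_gen D)) \<in> down_up_ideal \<alpha> (\<beta> :: 'k::field)" (is ?B)
proof -
  interpret ring "free_algebra :: ('k, 'k free_alg) module" by (rule ring_free_algebra)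
  show ?A ?B
    unfolding down_up_ideal_def Let_def
    by (rule subsetD[OF genideal_self]; simp add: free_algebra_def)+
qed

text \<open>The trace property is left out because \<open>zero_if_zero_on_pbw\<close> applies the
  locale to functionals y \<mapsto> \<phi> (x y), which need not be traces.\<close>

locale down_up_functional =
  fixes q p :: "'k::field" and \<phi> :: "'k free_alg \<Rightarrow> 'k"
  assumes q: "q \<noteq> 0"
    and add: "\<phi> (x + y) = \<phi> x + \<phi> y"
    and scale: "\<phi> (free_smult c x) = c * \<phi> x"
    and vanishes: "x \<in> down_up_ideal (p + q) (- (p * q)) \<Longrightarrow> \<phi> x = 0"
begin

abbreviation u where "u \<equiv> free_gen U"
abbreviation d where "d \<equiv> free_gen D"
abbreviation w where "w \<equiv> free_w q p"

lemma diff: "\<phi> (x - y) = \<phi> x - \<phi> y"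
  using add[of "x - y" y] by simp

lemma vanishes_two_sided:
  assumes "x \<in> down_up_ideal (p + q) (- (p * q))"
  shows "\<phi> (a * (x * b)) = 0"
proof -
  interpret ideal "down_up_ideal (p + q) (- (p * q))" "free_algebra :: ('k, 'k free_alg) module"
    by (rule ideal_down_up_ideal)
  have "x * b \<in> down_up_ideal (p + q) (- (p * q))"
    using I_r_closed[OF assms, of b] by (simp add: free_algebra_def)
  then have "a * (x * b) \<in> down_up_ideal (p + q) (- (p * q))"
    using I_l_closed[of "x * b" a] by (simp add: free_algebra_def)
  then show ?thesis by (rule vanishes)
qed

lemmas expand = add diff scale algebra_simps mult_free_smult_left mult_free_smult_right

text \<open>The relations are used only under \<phi>, inside a context \<open>a\<close>,
  \<open>b\<close>; products are nested to the right so that the rules chain after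
  \<open>mult.assoc\<close>. This one is the definition of w solved for d u.\<close>

lemma du: "\<phi> (a * (d * (u * b))) = p * \<phi> (a * (u * (d * b))) + \<phi> (a * (w * b)) / q"
proof -
  have "\<phi> (a * (w * b)) = - (p * q) * \<phi> (a * (u * (d * b))) + q * \<phi> (a * (d * (u * b)))"
    by (simp add: free_w_def expand)
  then show ?thesis
    using q by (simp add: field_simps)
qed

text \<open>After expanding w, the difference d w - q w d is q times the first down-up
  relation.\<close>

lemma dw: "\<phi> (a * (d * (w * b))) = q * \<phi> (a * (w * (d * b)))"
proof -
  have "\<phi> (a * ((d * d * u - (free_smult (p + q) (d * u * d) + free_smult (- (p * q)) (u * d * d))) * b)) = 0"
    by (rule vanishes_two_sided[OF down_up_relations(1)])
  then have eq: "\<phi> (a * (d * (d * (u * b)))) =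
      (p + q) * \<phi> (a * (d * (u * (d * b)))) - p * q * \<phi> (a * (u * (d * (d * b))))"
    by (simp add: expand)
  show ?thesis
    by (simp add: free_w_def expand eq)
qed

text \<open>Likewise w u - q u w is q times the second relation.\<close>

lemma wu: "\<phi> (a * (w * (u * b))) = q * \<phi> (a * (u * (w * b)))"
proof -
  have "\<phi> (a * ((d * u * u - (free_smult (p + q) (u * d * u) + free_smult (- (p * q)) (u * u * d))) * b)) = 0"
    by (rule vanishes_two_sided[OF down_up_relations(2)])
  then have eq: "\<phi> (a * (d * (u * (u * b)))) =
      (p + q) * \<phi> (a * (u * (d * (u * b)))) - p * q * \<phi> (a * (u * (u * (d * b))))"
    by (simp add: expand)
  show ?thesis
    by (simp add: free_w_def expand eq)
qed

lemma d_w_power: "\<phi> (a * (d * (w ^ j * b))) = q ^ j * \<phi> (a * (w ^ j * (d * b)))"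
proof (induction j arbitrary: a)
  case (Suc j)
  then show ?case
    using dw[of a "w ^ j * b"] Suc[of "a * w"] by (simp add: mult.assoc)
qed simp

lemma w_power_u: "\<phi> (a * (w ^ j * (u * b))) = q ^ j * \<phi> (a * (u * (w ^ j * b)))"
proof (induction j arbitrary: a)
  case (Suc j)
  then show ?case
    using wu[of a "w ^ j * b"] Suc[of "a * w"] by (simp add: mult.assoc)
qed simp

text \<open>The origin of \<open>cross_coeff\<close>: moving d across one more u creates a new w
  with factor p^i / q, and the w created before gains a factor q when the last u passes it. This is
  the recursion \<open>cross_coeff_Suc'\<close>.\<close>

lemma d_u_power:
  "\<phi> (a * (d * (u ^ i * b))) =
    p ^ i * \<phi> (a * (u ^ i * (d * b))) + cross_coeff q p i * \<phi> (a * (u ^ (i - 1) * (w * b)))"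
proof (induction i arbitrary: b)
  case (Suc i)
  have shift: "u ^ i * (u * x) = u ^ Suc i * x" for x i
    by (simp add: power_commutes mult.assoc[symmetric])
  have "\<phi> (a * (d * (u ^ Suc i * b))) = \<phi> (a * (d * (u ^ i * (u * b))))"
    unfolding shift ..
  also have "\<dots> = p ^ i * \<phi> (a * (u ^ i * (d * (u * b)))) +
      cross_coeff q p i * \<phi> (a * (u ^ (i - 1) * (w * (u * b))))"
    by (rule Suc)
  also have "\<phi> (a * (u ^ i * (d * (u * b)))) =
      p * \<phi> (a * (u ^ Suc i * (d * b))) + \<phi> (a * (u ^ i * (w * b))) / q"
    using du[of "a * u ^ i" b] shift[of i "d * b"] by (simp only: mult.assoc)
  also have "cross_coeff q p i * \<phi> (a * (u ^ (i - 1) * (w * (u * b)))) =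
      q * cross_coeff q p i * \<phi> (a * (u ^ i * (w * b)))"
    using wu[of "a * u ^ (i - 1)" b] shift[of "i - 1" "w * b"]
    by (cases i) (simp_all add: mult.assoc del: power_Suc cross_coeff.simps(2))
  finally show ?case
    unfolding cross_coeff_Suc' by (simp add: algebra_simps add_divide_distrib)
qed simp

lemma d_power_u:
  "\<phi> (a * (d ^ k * (u * b))) =
    p ^ k * \<phi> (a * (u * (d ^ k * b))) + cross_coeff q p k * \<phi> (a * (w * (d ^ (k - 1) * b)))"
proof (induction k arbitrary: a)
  case (Suc k)
  have "\<phi> (a * (d ^ Suc k * (u * b))) = \<phi> ((a * d) * (d ^ k * (u * b)))"
    by (simp add: mult.assoc)
  also have "\<dots> = p ^ k * \<phi> (a * (d * (u * (d ^ k * b)))) +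
      cross_coeff q p k * \<phi> (a * (d * (w * (d ^ (k - 1) * b))))"
    unfolding Suc by (simp add: mult.assoc)
  also have "\<phi> (a * (d * (u * (d ^ k * b)))) =
      p * \<phi> (a * (u * (d ^ Suc k * b))) + \<phi> (a * (w * (d ^ k * b))) / q"
    using du[of a "d ^ k * b"] by (simp add: mult.assoc)
  also have "cross_coeff q p k * \<phi> (a * (d * (w * (d ^ (k - 1) * b)))) =
      q * cross_coeff q p k * \<phi> (a * (w * (d ^ k * b)))"
    using dw[of a "d ^ (k - 1) * b"] by (cases k) (simp_all add: mult.assoc del: cross_coeff.simps(2))
  finally show ?case
    unfolding cross_coeff_Suc' by (simp add: algebra_simps add_divide_distrib)
qed simp

lemma lmul_values: "\<phi> (free_gen x * pbw q p i j k) = lmul q p x (\<lambda>i j k. \<phi> (pbw q p i j k)) i j k"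
proof (cases x)
  case U
  then show ?thesis by (simp add: pbw_def mult.assoc)
next
  case D
  have "\<phi> (d * pbw q p i j k) = p ^ i * \<phi> (u ^ i * (d * (w ^ j * d ^ k))) +
      cross_coeff q p i * \<phi> (u ^ (i - 1) * (w ^ Suc j * d ^ k))"
    using d_u_power[of 1 i "w ^ j * d ^ k"] by (simp add: pbw_def mult.assoc)
  then show ?thesis
    using d_w_power[of "u ^ i" j "d ^ k"] D by (simp add: pbw_def mult.assoc)
qed

lemma rmul_values: "\<phi> (pbw q p i j k * free_gen x) = rmul q p x (\<lambda>i j k. \<phi> (pbw q p i j k)) i j k"
proof (cases x)
  case D
  then show ?thesis by (simp add: pbw_def mult.assoc power_commutes)
next
  case U
  have "\<phi> (pbw q p i j k * u) = p ^ k * \<phi> (u ^ i * (w ^ j * (u * d ^ k))) +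
      cross_coeff q p k * \<phi> (u ^ i * (w ^ j * (w * d ^ (k - 1))))"
    using d_power_u[of "u ^ i * w ^ j" k 1] by (simp add: pbw_def mult.assoc)
  moreover have "w ^ j * (w * x) = w ^ Suc j * x" "u ^ i * (u * x) = u ^ Suc i * x" for x
    by (simp_all add: power_commutes mult.assoc[symmetric])
  ultimately show ?thesis
    using w_power_u[of "u ^ i" j "d ^ k"] U by (simp add: pbw_def mult.assoc)
qed

text \<open>Induction on the word by removing its first letter x: the functional is replaced by y
  \<mapsto> \<phi> (x y), which again vanishes on all monomials by \<open>lmul_values\<close>. No
  word has to be rewritten in terms of monomials.\<close>

lemma zero_if_zero_on_pbw:
  assumes "\<And>i j k. \<phi> (pbw q p i j k) = 0"
  shows "\<phi> x = 0"
proof (induction x rule: free_alg_induct)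
  case (single v c)
  obtain xs where v: "v = Word xs" by (cases v)
  have "\<psi> (Poly_Mapping.single (Word xs) c) = 0"
    if "down_up_functional q p \<psi>" "\<And>i j k. \<psi> (pbw q p i j k) = 0" for \<psi>
    using that
  proof (induction xs arbitrary: \<psi>)
    case Nil
    then interpret \<psi>: down_up_functional q p \<psi> by simp
    have "Poly_Mapping.single (Word []) c = free_smult c (pbw q p 0 0 0)"
      by (simp add: pbw_def free_smult_conv_mult zero_word_def)
    then show ?case using Nil(2) \<psi>.scale by simp
  next
    case (Cons x xs)
    interpret \<psi>: down_up_functional q p \<psi> by (rule Cons)
    have "down_up_functional q p (\<lambda>y. \<psi> (free_gen x * y))"
      using \<psi>.vanishes_two_sided[of _ "free_gen x" 1]
      by unfold_locales (simp_all add: q \<psi>.add \<psi>.scale distrib_left mult_free_smult_right)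
    moreover have "\<psi> (free_gen x * pbw q p i j k) = 0" for i j k
      unfolding \<psi>.lmul_values by (cases x) (simp_all add: Cons.prems(2))
    ultimately show ?case
      unfolding single_Word_Cons by (rule Cons.IH)
  qed
  then show ?case
    unfolding v using assms down_up_functional_axioms by blast
qed (simp add: add)

end

lemma tracial_values:
  assumes "q \<noteq> 0" "trace_functional (down_up_ideal (p + q) (- (p * q))) \<phi>"
  shows "tracial q p (\<lambda>i j k. \<phi> (pbw q p i j k))"
proof -
  interpret down_up_functional q p \<phi>
    using assms by unfold_locales (auto simp: trace_functional_def)
  show ?thesis
    using assms(2) unfolding tracial_def trace_functional_def
    by (auto simp: lmul_values[symmetric] rmul_values[symmetric] fun_eq_iff)
qed

definition trace_basis :: "'k::field \<Rightarrow> 'k \<Rightarrow> (nat \<times> nat \<times> nat) set \<Rightarrow> bool" where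
  "trace_basis q p T \<longleftrightarrow>
    (\<forall>i j k. (i, j, k) \<in> T \<longrightarrow> (\<exists>F. tracial q p F \<and> F i j k = 1 \<and>
      (\<forall>i' j' k'. (i', j', k') \<in> T \<longrightarrow> (i', j', k') \<noteq> (i, j, k) \<longrightarrow> F i' j' k' = 0))) \<and>
    (\<forall>F i j k. tracial q p F \<longrightarrow> (\<forall>i j k. (i, j, k) \<in> T \<longrightarrow> F i j k = 0) \<longrightarrow> F i j k = 0)"

lemma classes_form_basis_HH0_if_trace_basis:
  fixes q p :: "'k::field"
  assumes q: "q \<noteq> 0" and T: "trace_basis q p T"
  shows "classes_form_basis_HH0 (down_up_algebra (p + q) (- (p * q)))
    ((\<lambda>(i, j, k). down_up_ideal (p + q) (- (p * q)) +>\<^bsub>free_algebra\<^esub> pbw q p i j k) ` T)"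
proof -
  interpret free_alg_quotient "down_up_ideal (p + q) (- (p * q))" "down_up_algebra (p + q) (- (p * q))"
    by (simp add: free_alg_quotient_def ideal_down_up_ideal down_up_algebra_def)
  have "classes_form_basis_HH0 (down_up_algebra (p + q) (- (p * q)))
      ((\<lambda>t. coset ((\<lambda>(i, j, k). pbw q p i j k) t)) ` T)"
  proof (rule classes_form_basis_HH0I)
    fix t assume t: "t \<in> T"
    obtain i j k where ijk: "t = (i, j, k)" by (cases t)
    obtain F where F: "tracial q p F" "F i j k = 1"
      "\<And>i' j' k'. (i', j', k') \<in> T \<Longrightarrow> (i', j', k') \<noteq> (i, j, k) \<Longrightarrow> F i' j' k' = 0"
      using T t ijk unfolding trace_basis_def by metis
    have "functional_of q p F (case s of (i, j, k) \<Rightarrow> pbw q p i j k) = 0" if "s \<in> T" "s \<noteq> t" for s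
      using F(3) that unfolding ijk by (cases s) (simp only: prod.case functional_of_pbw[OF q])
    then show "\<exists>\<phi>. trace_functional (down_up_ideal (p + q) (- (p * q))) \<phi> \<and>
        \<phi> (case t of (i, j, k) \<Rightarrow> pbw q p i j k) = 1 \<and>
        (\<forall>s\<in>T. s \<noteq> t \<longrightarrow> \<phi> (case s of (i, j, k) \<Rightarrow> pbw q p i j k) = 0)"
      using trace_functional_functional_of[OF q F(1)] F(2)
      by (intro exI[of _ "functional_of q p F"]) (simp add: ijk functional_of_pbw[OF q])
  next
    fix \<phi> x
    assume \<phi>: "trace_functional (down_up_ideal (p + q) (- (p * q))) \<phi>"
      and zero_on_T: "\<forall>t\<in>T. \<phi> (case t of (i, j, k) \<Rightarrow> pbw q p i j k) = 0"
    interpret down_up_functional q p \<phi>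
      using q \<phi> by unfold_locales (auto simp: trace_functional_def)
    have "\<phi> (pbw q p i j k) = 0" if "(i, j, k) \<in> T" for i j k
      using zero_on_T that by fastforce
    then have "\<phi> (pbw q p i j k) = 0" for i j k
      using T tracial_values[OF q \<phi>] unfolding trace_basis_def by blast
    then show "\<phi> x = 0" by (rule zero_if_zero_on_pbw)
  qed
  then show ?thesis by (simp add: case_prod_unfold)
qed

section \<open>The trace equations\<close>

text \<open>At k = 0 or i = 0 the truncated index \<open>k - 1\<close> or \<open>i - 1\<close> is
  multiplied by \<open>cross_coeff q p 0\<close>, which is 0, so there the equations reduce to (1 -
  q^j) F = 0.\<close>

lemma tracial_iff:
  "tracial q p F \<longleftrightarrow>
    (\<forall>i j k. (1 - q ^ j * p ^ k) * F (Suc i) j k = cross_coeff q p k * F i (Suc j) (k - 1)) \<and>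
    (\<forall>i j k. (1 - p ^ i * q ^ j) * F i j (Suc k) = cross_coeff q p i * F (i - 1) (Suc j) k)"
  (is "_ \<longleftrightarrow> ?u \<and> ?d")
proof -
  have "tracial q p F \<longleftrightarrow> lmul q p U F = rmul q p U F \<and> lmul q p D F = rmul q p D F"
    unfolding tracial_def by (metis gen.exhaust)
  moreover have "lmul q p U F = rmul q p U F \<longleftrightarrow> ?u"
    by (auto simp: fun_eq_iff algebra_simps)
  moreover have "lmul q p D F = rmul q p D F \<longleftrightarrow> ?d"
    by (auto simp: fun_eq_iff algebra_simps)
  ultimately show ?thesis by simp
qed

lemma tracialD:
  assumes "tracial q p F"
  shows "(1 - q ^ j * p ^ k) * F (Suc i) j k = cross_coeff q p k * F i (Suc j) (k - 1)"
    and "(1 - p ^ i * q ^ j) * F i j (Suc k) = cross_coeff q p i * F (i - 1) (Suc j) k"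
  using assms unfolding tracial_iff by blast+

text \<open>Reflects the anti-automorphism that exchanges u and d and fixes w.\<close>

lemma tracial_swap: "tracial q p F \<Longrightarrow> tracial q p (\<lambda>i j k. F k j i)"
  unfolding tracial_iff by (simp add: mult.commute)

lemma trace_basisI:
  assumes indep: "\<And>i j k. (i, j, k) \<in> T \<Longrightarrow> \<exists>F. tracial q p F \<and> F i j k = 1 \<and>
      (\<forall>i' j' k'. (i', j', k') \<in> T \<longrightarrow> (i', j', k') \<noteq> (i, j, k) \<longrightarrow> F i' j' k' = 0)"
    and sym: "\<And>i j k. (i, j, k) \<in> T \<Longrightarrow> (k, j, i) \<in> T"
    and spanning: "\<And>F i j k. tracial q p F \<Longrightarrow> (\<And>i j k. (i, j, k) \<in> T \<Longrightarrow> F i j k = 0) \<Longrightarrow>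
      k \<le> i \<Longrightarrow> F i j k = 0"
  shows "trace_basis q p T"
proof -
  have "F i j k = 0" if "tracial q p F" "\<And>i j k. (i, j, k) \<in> T \<Longrightarrow> F i j k = 0" for F i j k
  proof (cases "k \<le> i")
    case True
    then show ?thesis using spanning that by blast
  next
    case False
    then show ?thesis
      using spanning[OF tracial_swap[OF that(1)], of i k j] that(2) sym by auto
  qed
  then show ?thesis
    unfolding trace_basis_def using indep by simp
qed

section \<open>Solutions supported at one point or on one line\<close>

definition delta_function :: "nat \<Rightarrow> nat \<Rightarrow> nat \<Rightarrow> nat \<Rightarrow> nat \<Rightarrow> 'k::field" where
  "delta_function i0 k0 i j k = (if i = i0 \<and> j = 0 \<and> k = k0 then 1 else 0)"

text \<open>With j = 0 the point is the last of its line, so its value occurs only on left-hand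
  sides, multiplied by 1 - p^k0 (if i0 > 0) and by 1 - p^i0 (if k0 > 0).\<close>

lemma tracial_delta_function:
  assumes "i0 > 0 \<Longrightarrow> p ^ k0 = 1" "k0 > 0 \<Longrightarrow> p ^ i0 = 1"
  shows "tracial q p (delta_function i0 k0)"
  unfolding tracial_iff using assms by (auto simp: delta_function_def)

text \<open>
  The trace relations only connect \<open>(i, j, k)\<close> with \<open>(i - 1, j + 1, k - 1)\<close>; this is their solution
  along such a line, started with value 1 at \<open>(i0, j0, k0)\<close>.  The convention \<open>x / 0 = 0\<close> ends the
  support of the function where a relation has coefficient 0.
\<close>

definition line_function :: "'k::field \<Rightarrow> 'k \<Rightarrow> nat \<Rightarrow> nat \<Rightarrow> nat \<Rightarrow> nat \<Rightarrow> nat \<Rightarrow> nat \<Rightarrow> 'k" where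
  "line_function q p i0 j0 k0 i j k =
    (if i + k0 = i0 + k \<and> i + j = i0 + j0 \<and> k0 \<le> k
     then \<Prod>l\<in>{k0<..k}. cross_coeff q p l / (1 - q ^ (j0 + k0 - l) * p ^ l) else 0)"

text \<open>\<open>periodic\<close> makes the two equations of a step identical, as i = l + i0 - k0
  there; \<open>start\<close> annihilates the coefficients of the equations into the starting point,
  before which the function is 0; \<open>vanishing\<close> makes both sides 0 wherever the recursion
  divides by 0.\<close>

lemma tracial_line_function:
  assumes periodic: "\<And>l. k0 < l \<Longrightarrow>
      cross_coeff q p (l + i0 - k0) = cross_coeff q p l \<and> p ^ (l + i0 - k0) = p ^ l"
    and start: "i0 > 0 \<or> k0 > 0 \<Longrightarrow> q ^ j0 * p ^ k0 = 1 \<and> p ^ i0 = p ^ k0"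
    and vanishing: "\<And>l. k0 < l \<Longrightarrow> l \<le> k0 + j0 \<Longrightarrow> q ^ (j0 + k0 - l) * p ^ l = 1 \<Longrightarrow>
      \<exists>m. k0 < m \<and> m \<le> l \<and> cross_coeff q p m = 0"
  shows "tracial q p (line_function q p i0 j0 k0)"
proof -
  define P where "P k = (\<Prod>l\<in>{k0<..k}. cross_coeff q p l / (1 - q ^ (j0 + k0 - l) * p ^ l))" for k
  have P_Suc: "P (Suc k) = P k * (cross_coeff q p (Suc k) / (1 - q ^ (j0 + k0 - Suc k) * p ^ Suc k))"
    if "k0 \<le> k" for k
  proof -
    have "{k0<..Suc k} = insert (Suc k) {k0<..k}" using that by auto
    then show ?thesis unfolding P_def by (simp add: mult.commute)
  qed
  have P_start: "P k0 = 1" by (simp add: P_def)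
  have P_zero: "P k = 0" if "k0 < m" "m \<le> k" "cross_coeff q p m = 0" for m k
    unfolding P_def using that by (intro prod_zero) auto
  have step: "(1 - q ^ (j0 + k0 - Suc k) * p ^ Suc k) * P (Suc k) = cross_coeff q p (Suc k) * P k"
    if k: "k0 \<le> k" "Suc k \<le> k0 + j0" for k
  proof (cases "q ^ (j0 + k0 - Suc k) * p ^ Suc k = 1")
    case True
    obtain m where "k0 < m" "m \<le> Suc k" "cross_coeff q p m = 0"
      using vanishing[of "Suc k"] True k by auto
    then have "cross_coeff q p (Suc k) * P k = 0"
      using P_zero[of m k] by (cases "m = Suc k") auto
    with True show ?thesis by simp
  next
    case False
    then show ?thesis by (simp add: P_Suc[OF k(1)])
  qed
  have line: "line_function q p i0 j0 k0 i j k =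
      (if i + k0 = i0 + k \<and> i + j = i0 + j0 \<and> k0 \<le> k then P k else 0)" for i j k
    by (simp add: line_function_def P_def)
  show ?thesis
    unfolding tracial_iff
  proof (intro conjI allI)
    fix i j k
    show "(1 - q ^ j * p ^ k) * line_function q p i0 j0 k0 (Suc i) j k =
        cross_coeff q p k * line_function q p i0 j0 k0 i (Suc j) (k - 1)"
    proof (cases "Suc i + k0 = i0 + k \<and> Suc i + j = i0 + j0 \<and> k0 < k")
      case True
      then obtain k' where k': "k = Suc k'" "k0 \<le> k'" by (cases k) auto
      have j: "j = j0 + k0 - Suc k'" "Suc k' \<le> k0 + j0" using True k' by auto
      show ?thesis
        using True k' step[OF k'(2) j(2)] unfolding line j(1)[symmetric] by simp
    next
      case False
      show ?thesis
      proof (cases "Suc i + k0 = i0 + k \<and> Suc i + j = i0 + j0 \<and> k0 = k")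
        case True
        then have "q ^ j * p ^ k = 1" using start by auto
        with True show ?thesis unfolding line by (cases k) auto
      next
        case ne: False
        with False show ?thesis unfolding line by (cases k) auto
      qed
    qed
  next
    fix i j k
    show "(1 - p ^ i * q ^ j) * line_function q p i0 j0 k0 i j (Suc k) =
        cross_coeff q p i * line_function q p i0 j0 k0 (i - 1) (Suc j) k"
    proof (cases "i + k0 = i0 + Suc k \<and> i + j = i0 + j0 \<and> k0 \<le> k")
      case True
      then have j: "j = j0 + k0 - Suc k" "Suc k \<le> k0 + j0" "k0 \<le> k" by auto
      have i: "i = Suc k + i0 - k0" "i > 0" using True by auto
      have per: "cross_coeff q p i = cross_coeff q p (Suc k)" "p ^ i = p ^ Suc k"
        using periodic[of "Suc k"] j(3) unfolding i(1) by auto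
      show ?thesis
        using True i(2) step[OF j(3,2)] unfolding line per j(1)[symmetric] 
        by (simp add: mult.commute)
    next
      case False
      show ?thesis
      proof (cases "i + k0 = i0 + Suc k \<and> i + j = i0 + j0 \<and> k0 = Suc k")
        case True
        then have ij: "i = i0" "j = j0" by auto
        have "q ^ j0 * p ^ k0 = 1" "p ^ i0 = p ^ k0" using start True by auto
        then have "p ^ i * q ^ j = 1" unfolding ij by (simp add: mult.commute)
        with True show ?thesis unfolding line by (cases i) auto
      next
        case ne: False
        with False show ?thesis unfolding line by (cases i) auto
      qed
    qed
  qed
qed

lemma line_function_start: "line_function q p i0 j0 k0 i0 j0 k0 = 1"
  by (simp add: line_function_def)

lemma line_function_eq_0:
  assumes "(i, j, k) \<noteq> (i0, j0, k0)" "k > k0 \<Longrightarrow> q ^ j * p ^ k = 1"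
  shows "line_function q p i0 j0 k0 i j k = 0"
proof (cases "i + k0 = i0 + k \<and> i + j = i0 + j0 \<and> k0 \<le> k")
  case True
  with assms(1) have k: "k > k0" "j = j0 + k0 - k" by auto
  \<comment> \<open>The factor for l = k has denominator 1 - q^j p^k = 0, so it is 0 by
    convention.\<close>
  have "(\<Prod>l\<in>{k0<..k}. cross_coeff q p l / (1 - q ^ (j0 + k0 - l) * p ^ l)) = 0"
    by (rule prod_zero) (use k assms(2) in \<open>auto intro!: bexI[of _ k]\<close>)
  then show ?thesis by (simp add: line_function_def)
next
  case False
  then show ?thesis unfolding line_function_def by (rule if_not_P)
qed

lemma line_function_eq_0_off_line:
  assumes "i + k0 \<noteq> i0 + k \<or> i + j \<noteq> i0 + j0 \<or> k < k0"
  shows "line_function q p i0 j0 k0 i j k = 0"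
  using assms by (auto simp: line_function_def)

section \<open>Solutions for the two families\<close>

text \<open>A coefficient 1 - q^j p^k is 0 only for j = k = 0. For k \<le> i, going back along the
  line leads to the boundary k = 0, where F is forced to be 0 unless i = 0 or j = 0.\<close>

lemma trace_basis_generic:
  fixes q p :: "'k::field"
  assumes generic: "\<And>a b :: nat. q ^ a * p ^ b = 1 \<Longrightarrow> a = 0 \<and> b = 0"
  shows "trace_basis q p ({(0, 0, 0)} \<union> {(0, j, 0) | j. j \<ge> 1} \<union> {(0, 0, k) | k. k \<ge> 1} \<union> {(i, 0, 0) | i. i \<ge> 1})"
    (is "trace_basis q p ?T")
proof (rule trace_basisI)
  fix i j k assume t: "(i, j, k) \<in> ?T"
  show "\<exists>F. tracial q p F \<and> F i j k = 1 \<and>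
      (\<forall>i' j' k'. (i', j', k') \<in> ?T \<longrightarrow> (i', j', k') \<noteq> (i, j, k) \<longrightarrow> F i' j' k' = 0)"
  proof (cases "i = 0 \<and> k = 0")
    case True
    \<comment> \<open>On the diagonal i = k the two equations of a step coincide, and no denominator
      is 0.\<close>
    have "tracial q p (line_function q p 0 j 0)"
    proof (rule tracial_line_function)
      fix l assume "0 < l" "q ^ (j + 0 - l) * p ^ l = 1"
      then show "\<exists>m. 0 < m \<and> m \<le> l \<and> cross_coeff q p m = 0"
        using generic by blast
    qed auto
    moreover have "line_function q p 0 j 0 i' j' k' = 0" if "(i', j', k') \<in> ?T" "(i', j', k') \<noteq> (0, j, 0)" for i' j' k'
      using that by (auto simp: line_function_def)
    ultimately show ?thesis
      using True line_function_start[of q p 0 j 0] by blast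
  next
    case False
    with t have "j = 0" by auto
    moreover have "tracial q p (delta_function i k)"
      using t by (intro tracial_delta_function) auto
    ultimately show ?thesis
      by (intro exI[of _ "delta_function i k"]) (auto simp: delta_function_def)
  qed
next
  fix F :: "nat \<Rightarrow> nat \<Rightarrow> nat \<Rightarrow> 'k" and i j k :: nat
  assume F: "tracial q p F" and T: "\<And>i j k. (i, j, k) \<in> ?T \<Longrightarrow> F i j k = 0"
  assume "k \<le> i"
  then show "F i j k = 0"
  proof (induction k arbitrary: i j)
    case 0
    show ?case
    proof (cases "i = 0 \<or> j = 0")
      case True
      then show ?thesis by (intro T) auto
    next
      case False
      then obtain i' where "i = Suc i'" "q ^ j * p ^ 0 \<noteq> 1" using generic[of j 0] by (cases i) auto
      then show ?thesis using tracialD(1)[OF F, of j 0 i'] by auto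
    qed
  next
    case (Suc k)
    then obtain i' where i': "i = Suc i'" "k \<le> i'" by (cases i) auto
    have "q ^ j * p ^ Suc k \<noteq> 1" using generic[of j "Suc k"] by auto
    then show ?case using tracialD(1)[OF F, of j "Suc k" i'] Suc.IH[OF i'(2)] i'(1) by auto
  qed
qed auto

section \<open>Family (F2): the order of the root and the zeros of the coefficients\<close>

lemma mult_order_dvd_iff:
  assumes "q \<noteq> 0"
  shows "q ^ m = 1 \<longleftrightarrow> mult_order q dvd m"
proof (cases "\<exists>m>0. q ^ m = 1")
  case True
  define n where "n = (LEAST m. m > 0 \<and> q ^ m = 1)"
  have n: "n > 0" "q ^ n = 1" unfolding n_def using LeastI_ex[OF True] by auto
  have least: "q ^ r \<noteq> 1" if "0 < r" "r < n" for r
    using not_less_Least[of r "\<lambda>m. m > 0 \<and> q ^ m = 1"] that unfolding n_def by blast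
  have "q ^ m = q ^ (m mod n)"
    by (metis n(2) div_mult_mod_eq mult.commute mult_1 power_add power_mult power_one)
  then have "q ^ m = 1 \<longleftrightarrow> m mod n = 0"
    using least[of "m mod n"] n(1) by auto
  with True show ?thesis by (simp add: mult_order_def n_def mod_eq_0_iff_dvd)
next
  case False
  then have "mult_order q = 0" unfolding mult_order_def by (rule if_not_P)
  with False show ?thesis by auto
qed

lemma power_eq_iff_mult_order:
  assumes "q \<noteq> 0"
  shows "q ^ a = q ^ b \<longleftrightarrow> int (mult_order q) dvd int a - int b"
proof -
  have *: "q ^ a = q ^ b \<longleftrightarrow> int (mult_order q) dvd int a - int b" if "b \<le> a" for a b
  proof -
    have "q ^ a = q ^ b * q ^ (a - b)" using that by (simp flip: power_add)
    then have "q ^ a = q ^ b \<longleftrightarrow> q ^ (a - b) = 1" using assms by simp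
    also have "\<dots> \<longleftrightarrow> int (mult_order q) dvd int (a - b)"
      by (simp add: mult_order_dvd_iff[OF assms])
    finally show ?thesis using that by (simp add: of_nat_diff)
  qed
  show ?thesis
    using *[of a b] *[of b a] by (metis dvd_diff_commute nat_le_linear)
qed

locale inverse_roots =
  fixes q p :: "'k::field"
  assumes qp: "q * p = 1"
begin

lemma q_nonzero: "q \<noteq> 0"
  using qp by auto

abbreviation g where "g \<equiv> cross_coeff q p"

lemma power_mult_eq_1_iff: "q ^ a * p ^ b = 1 \<longleftrightarrow> q ^ a = q ^ b"
proof -
  have "q ^ b * p ^ b = 1" using qp by (simp flip: power_mult_distrib)
  then have "q ^ a * p ^ b = 1 \<longleftrightarrow> q ^ a * p ^ b = q ^ b * p ^ b" by simp
  also have "\<dots> \<longleftrightarrow> q ^ a = q ^ b" using qp by auto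
  finally show ?thesis .
qed

lemma p_power_eq_iff: "p ^ a = p ^ b \<longleftrightarrow> q ^ a = q ^ b"
proof -
  have "p = inverse q" using qp by (simp add: inverse_unique)
  then show ?thesis by (simp add: power_inverse)
qed

text \<open>One step along a line by either equation: the first determines the new value unless j
  \<equiv> k, the second unless j \<equiv> i, modulo the order of q.\<close>

lemma level:
  assumes "tracial q p F"
  shows "q ^ j \<noteq> q ^ k \<Longrightarrow> g k * F i (Suc j) (k - 1) = 0 \<Longrightarrow> F (Suc i) j k = 0"
    and "q ^ j \<noteq> q ^ i \<Longrightarrow> g i * F (i - 1) (Suc j) k = 0 \<Longrightarrow> F i j (Suc k) = 0"
  using tracialD(1)[OF assms, of j k i] tracialD(2)[OF assms, of i j k]
    power_mult_eq_1_iff[of j k] power_mult_eq_1_iff[of j i]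
  by (auto simp: mult.commute)

text \<open>The geometric sum for c_k with 1/q = p, multiplied out by q - p to avoid
  division.\<close>

lemma cross_coeff_closed_form: "g k * (q - p) = p * (q ^ k - p ^ k)"
proof (induction k)
  case (Suc k)
  have "q ^ k / q = q ^ k * p" using qp q_nonzero by (simp add: field_simps)
  then have "g (Suc k) * (q - p) = p * (g k * (q - p)) + q ^ k * p * (q - p)"
    by (simp add: algebra_simps)
  also have "\<dots> = p * (q ^ Suc k - p ^ Suc k)"
    unfolding Suc by (simp add: algebra_simps)
  finally show ?case .
qed simp

end

text \<open>Equivalent to q \<noteq> p, so that q - p can be cancelled in the closed form; q = 1 and
  q = -1 remain.\<close>

locale inverse_roots_nondegenerate = inverse_roots +
  assumes qq: "q ^ 2 \<noteq> 1"
begin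

lemma q_ne_p: "q - p \<noteq> 0"
  using qp qq by (auto simp: power2_eq_square)

lemma g_eq_0_iff: "g k = 0 \<longleftrightarrow> q ^ (2 * k) = 1"
proof -
  have "g k = 0 \<longleftrightarrow> q ^ k = p ^ k"
    using cross_coeff_closed_form[of k] q_ne_p qp by (metis mult_eq_0_iff mult_zero_right right_minus_eq zero_neq_one)
  also have "\<dots> \<longleftrightarrow> q ^ k * q ^ k = q ^ k * p ^ k"
    using q_nonzero by simp
  also have "q ^ k * p ^ k = 1"
    using qp by (simp flip: power_mult_distrib)
  also have "q ^ k * q ^ k = q ^ (2 * k)"
    by (simp add: mult_2 power_add)
  finally show ?thesis .
qed

lemma g_cong: "q ^ a = q ^ b \<Longrightarrow> g a = g b"
  using cross_coeff_closed_form[of a] cross_coeff_closed_form[of b] q_ne_p p_power_eq_iff[of a b]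
  by (metis mult_right_cancel)

text \<open>
  Where the coefficient \<open>1 - q\<^sup>j\<^sup>-\<^sup>K p\<^sup>K\<close> vanishes, the relation forces \<open>F\<close> to be 0 one step below; for the
  least such \<open>K\<close> no \<open>cross_coeff\<close> on the way down to \<open>w\<^sup>j\<close> is 0.
\<close>

lemma diagonal_zero:
  assumes F: "tracial q p F" and K: "1 \<le> K" "K \<le> j" "q ^ (j - K) = q ^ K" and j: "q ^ j \<noteq> 1"
  shows "F 0 j 0 = 0"
proof -
  define L where "L = (LEAST l. 1 \<le> l \<and> l \<le> j \<and> q ^ (j - l) = q ^ l)"
  have L: "1 \<le> L" "L \<le> j" "q ^ (j - L) = q ^ L"
    unfolding L_def using LeastI[of "\<lambda>l. 1 \<le> l \<and> l \<le> j \<and> q ^ (j - l) = q ^ l" K] K by auto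
  have least: "\<not> (1 \<le> l \<and> q ^ (j - l) = q ^ l)" if "l < L" for l
    using not_less_Least[of l "\<lambda>l. 1 \<le> l \<and> l \<le> j \<and> q ^ (j - l) = q ^ l"] that L(2) unfolding L_def by auto
  \<comment> \<open>If g l = 0, then q^(2l) = 1 and L - l satisfies the same equation as L. This
    contradicts minimality, or q^j \<noteq> 1 when l = L.\<close>
  have g: "g l \<noteq> 0" if "1 \<le> l" "l \<le> L" for l
  proof
    assume "g l = 0"
    then have l: "q ^ (2 * l) = 1" by (simp add: g_eq_0_iff)
    have "q ^ (j - (L - l)) = q ^ (j - L) * q ^ l"
      using that L(1,2) by (simp flip: power_add)
    also have "\<dots> = q ^ (L - l) * q ^ (2 * l)"
      unfolding L(3) using that by (simp add: add.commute flip: power_add)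
    finally have "q ^ (j - (L - l)) = q ^ (L - l)" using l by simp
    with least[of "L - l"] that j show False by (cases "l = L") auto
  qed
  \<comment> \<open>The left-hand side of the relation is 0, at L through its coefficient and for
    smaller indices through the value already shown to be 0; the nonzero g (l + 1) is then
    cancelled.\<close>
  have step: "F l (j - l) l = 0" if "l < L" "F (Suc l) (j - Suc l) (Suc l) = 0 \<or> Suc l = L" for l
  proof -
    have "(1 - q ^ (j - Suc l) * p ^ Suc l) * F (Suc l) (j - Suc l) (Suc l) =
        g (Suc l) * F l (Suc (j - Suc l)) l"
      using tracialD(1)[OF F, of "j - Suc l" "Suc l" l] by simp
    moreover have "(1 - q ^ (j - Suc l) * p ^ Suc l) * F (Suc l) (j - Suc l) (Suc l) = 0"
      using that(2) power_mult_eq_1_iff[of "j - Suc l" "Suc l"] L(3) by auto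
    moreover have "Suc (j - Suc l) = j - l" using that(1) L(2) by simp
    ultimately show ?thesis using g[of "Suc l"] that(1) by simp
  qed
  have "F (L - Suc m) (j - (L - Suc m)) (L - Suc m) = 0" if "m < L" for m
    using that
  proof (induction m)
    case 0
    then show ?case using step[of "L - 1"] L(1) by simp
  next
    case (Suc m)
    then have "Suc (L - Suc (Suc m)) = L - Suc m" by simp
    then show ?case using step[of "L - Suc (Suc m)"] Suc by simp
  qed
  from this[of "L - 1"] show ?thesis using L(1) by simp
qed

text \<open>
  The two relations at \<open>(i + 1, j - 1, 1)\<close> both express \<open>F i j 0\<close> by \<open>F (i + 1) (j - 1) 1\<close>, with factors
  that differ unless \<open>q\<^sup>i = 1\<close>.
\<close>

lemma edge_zero:
  assumes F: "tracial q p F" and i: "q ^ i \<noteq> 1" and j: "q ^ j = 1" "j > 0"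
  shows "F i j 0 = 0"
proof -
  obtain j' where j': "j = Suc j'" using j(2) by (cases j) auto
  define x where "x = F (Suc i) j' 1"
  have qj': "q ^ j' = p"
    using j(1) qp unfolding j' by (metis mult.commute mult.left_neutral mult.left_commute power_Suc mult.right_neutral)
  have q1: "1 / q = p" using qp q_nonzero by (simp add: field_simps)
  have "(1 - p * p) * x = p * F i j 0"
    using tracialD(1)[OF F, of j' 1 i] unfolding qj' j' x_def by (simp add: q1)
  then have "q * ((1 - p * p) * x) = q * (p * F i j 0)" by simp
  moreover have "q * (p * F i j 0) = F i j 0" using qp by (simp flip: mult.assoc)
  moreover have "q * ((1 - p * p) * x) = (q - q * p * p) * x" by (simp add: algebra_simps)
  ultimately have Fx: "F i j 0 = (q - p) * x" using qp by simp
  \<comment> \<open>By the closed form g (i + 1) (q - p) is p (q^(i+1) - p^(i+1)), and what remains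
    of the second equation is (1 - q^i) x = 0.\<close>
  have "(1 - p ^ Suc i * p) * x = g (Suc i) * F i j 0"
    using tracialD(2)[OF F, of "Suc i" j' 0] unfolding qj' j' x_def by simp
  also have "\<dots> = p * (q ^ Suc i - p ^ Suc i) * x"
    unfolding Fx cross_coeff_closed_form[symmetric] by (simp add: algebra_simps del: cross_coeff.simps)
  also have "p * (q ^ Suc i - p ^ Suc i) = (q * p) * q ^ i - p ^ Suc i * p"
    by (simp add: algebra_simps)
  finally have "(1 - q ^ i) * x = 0" unfolding qp by (simp add: algebra_simps)
  with i have "x = 0" by simp
  with Fx show ?thesis by simp
qed

text \<open>The zeros of g are the multiples of the order h of q^2, and h divides b - a; the witness
  is the largest multiple of h up to b.\<close>

lemma vanishing_coeff_in_interval: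
  assumes "a < b" "q ^ (2 * (b - a)) = 1"
  shows "\<exists>m. a < m \<and> m \<le> b \<and> g m = 0"
proof -
  define h where "h = mult_order (q ^ 2)"
  have h: "q ^ (2 * m) = 1 \<longleftrightarrow> h dvd m" for m
    using mult_order_dvd_iff[of "q ^ 2" m] q_nonzero by (simp add: h_def power_mult)
  have hd: "h dvd b - a" using h assms(2) by blast
  then have h0: "h > 0" "h \<le> b - a" using assms(1) dvd_pos_nat[OF _ hd] dvd_imp_le[OF hd] by auto
  have "b mod h < h" using h0 by simp
  then have "a < b - b mod h" using h0(2) assms(1) by linarith
  moreover have "h dvd b - b mod h" by (simp add: dvd_minus_mod)
  ultimately show ?thesis
    using h g_eq_0_iff by (intro exI[of _ "b - b mod h"]) auto
qed

text \<open>\<open>J\<close> collects the j for which the diagonal line from (0, j, 0) meets no zero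
  coefficient; only here do even and odd order differ. For other j with q^j \<noteq> 1,
  \<open>diagonal_zero\<close> applies.\<close>

lemma trace_basis_nondegenerate:
  assumes J: "\<And>j l. j \<in> J \<Longrightarrow> l \<le> j \<Longrightarrow> q ^ (j - l) \<noteq> q ^ l"
    and J_span: "\<And>j. j \<notin> J \<Longrightarrow> q ^ j \<noteq> 1 \<Longrightarrow> \<exists>K. 1 \<le> K \<and> K \<le> j \<and> q ^ (j - K) = q ^ K"
  shows "trace_basis q p ({(i, j, k) | i j k. q ^ j = q ^ i \<and> q ^ j = q ^ k} \<union> {(i, 0, 0) | i. q ^ i \<noteq> 1} \<union>
      {(0, 0, k) | k. q ^ k \<noteq> 1} \<union> {(0, j, 0) | j. j \<in> J})" (is "trace_basis q p ?T")
proof (rule trace_basisI)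
  fix i j k assume t: "(i, j, k) \<in> ?T"
  then consider "q ^ j = q ^ i" "q ^ j = q ^ k" | "i = 0" "k = 0" "j \<in> J" | "j = 0" "i = 0 \<or> k = 0"
    by auto
  then show "\<exists>F. tracial q p F \<and> F i j k = 1 \<and>
      (\<forall>i' j' k'. (i', j', k') \<in> ?T \<longrightarrow> (i', j', k') \<noteq> (i, j, k) \<longrightarrow> F i' j' k' = 0)"
  proof cases
    case 1
    \<comment> \<open>Such a point can start a solution, since every equation into it has
      coefficient 0.\<close>
    have tracial: "tracial q p (line_function q p i j k)"
    proof (rule tracial_line_function)
      fix l assume l: "k < l"
      have "q ^ (l + i - k) = q ^ (l - k) * q ^ i" using l by (simp flip: power_add)
      also have "\<dots> = q ^ (l - k) * q ^ k" using 1 by simp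
      also have "\<dots> = q ^ l" using l by (simp flip: power_add)
      finally show "g (l + i - k) = g l \<and> p ^ (l + i - k) = p ^ l"
        using g_cong p_power_eq_iff by blast
    next
      show "q ^ j * p ^ k = 1 \<and> p ^ i = p ^ k"
        using 1 power_mult_eq_1_iff p_power_eq_iff by metis
    next
      \<comment> \<open>As q^j = q^k, a zero coefficient at l means q^(2(l - k)) = 1, so some
        \<open>g m\<close> with k < m \<le> l is 0.\<close>
      fix l assume l: "k < l" "l \<le> k + j" "q ^ (j + k - l) * p ^ l = 1"
      have "q ^ (j + k - l) * q ^ (l - k) = q ^ j" using l by (simp flip: power_add)
      moreover have "q ^ l = q ^ k * q ^ (l - k)" using l by (simp flip: power_add)
      moreover have "q ^ (j + k - l) = q ^ l" using l(3) power_mult_eq_1_iff by blast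
      ultimately have "q ^ j * (q ^ (l - k) * q ^ (l - k)) = q ^ j" using 1 by (simp add: mult.assoc)
      then have "q ^ (2 * (l - k)) = 1" using q_nonzero by (simp add: mult_2 power_add)
      then show "\<exists>m. k < m \<and> m \<le> l \<and> g m = 0" using vanishing_coeff_in_interval l(1) by blast
    qed
    have zero: "line_function q p i j k i' j' k' = 0"
      if s: "(i', j', k') \<in> ?T" "(i', j', k') \<noteq> (i, j, k)" for i' j' k'
    proof -
      \<comment> \<open>Another point of \<open>T\<close> on the same line lies before the start, or
        has q^j' = q^k' and then the last factor of the product is a division by 0.\<close>
      consider "q ^ j' = q ^ k'" | "k' = 0" | "i' = 0" "k' > 0"
        using s(1) by auto
      then show ?thesis
      proof cases
        case 1
        then show ?thesis using s(2) power_mult_eq_1_iff by (intro line_function_eq_0) auto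
      next
        case 2
        then show ?thesis using s(2) by (intro line_function_eq_0) auto
      next
        case 3
        then show ?thesis
          using s(2) by (cases "k < k'") (auto intro: line_function_eq_0 line_function_eq_0_off_line)
      qed
    qed
    show ?thesis
      by (rule exI[of _ "line_function q p i j k"], intro conjI allI impI)
        (rule tracial, rule line_function_start, rule zero)
  next
    case 2
    have tracial: "tracial q p (line_function q p 0 j 0)"
      using J[OF 2(3)] power_mult_eq_1_iff by (intro tracial_line_function) auto
    have zero: "line_function q p 0 j 0 i' j' k' = 0"
      if s: "(i', j', k') \<in> ?T" "(i', j', k') \<noteq> (0, j, 0)" for i' j' k'
    proof (cases "i' = k' \<and> i' + j' = j \<and> k' > 0")
      case True
      then have "q ^ j' \<noteq> q ^ k'" using J[OF 2(3), of k'] by auto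
      with s(1) True show ?thesis by auto
    next
      case False
      then show ?thesis using s(2) by (auto simp: line_function_def)
    qed
    show ?thesis
      unfolding 2(1,2)
      by (rule exI[of _ "line_function q p 0 j 0"], intro conjI allI impI)
        (rule tracial, rule line_function_start, rule zero)
  next
    case 3
    have "tracial q p (delta_function i k)"
      using 3 by (intro tracial_delta_function) auto
    then show ?thesis
      using 3 by (intro exI[of _ "delta_function i k"]) (auto simp: delta_function_def)
  qed
next
  fix F :: "nat \<Rightarrow> nat \<Rightarrow> nat \<Rightarrow> 'a" and i j k :: nat
  assume F: "tracial q p F" and T: "\<And>i j k. (i, j, k) \<in> ?T \<Longrightarrow> F i j k = 0"
  assume "k \<le> i"
  then show "F i j k = 0"
  proof (induction k arbitrary: i j)
    case 0
    consider "q ^ j = 1" "q ^ i = 1" | "q ^ j = 1" "q ^ i \<noteq> 1" | "q ^ j \<noteq> 1" "i > 0" | "q ^ j \<noteq> 1" "i = 0"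
      by blast
    then show ?case
    proof cases
      case 1
      then show ?thesis by (intro T) auto
    next
      case 2
      show ?thesis
      proof (cases "j = 0")
        case True
        then show ?thesis using 2 by (intro T) auto
      next
        case False
        then show ?thesis using edge_zero[OF F] 2 by blast
      qed
    next
      case 3
      then show ?thesis using level(1)[OF F, of j 0 "i - 1"] by simp
    next
      case 4
      show ?thesis
      proof (cases "j \<in> J")
        case True
        then show ?thesis using 4 by (intro T) auto
      next
        case False
        then show ?thesis using diagonal_zero[OF F] J_span 4 by blast
      qed
    qed
  next
    case (Suc k)
    then obtain i' where i': "i = Suc i'" "k \<le> i'" by (cases i) auto
    have IH: "F i' (Suc j) k = 0" using Suc.IH i' by blast
    \<comment> \<open>Unless the point is in \<open>T\<close>, one of the two equations has a
      nonzero coefficient, and both lead back to the same predecessor.\<close>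
    consider "q ^ j = q ^ i" "q ^ j = q ^ Suc k" | "q ^ j \<noteq> q ^ Suc k" | "q ^ j \<noteq> q ^ i" by blast
    then show ?case
    proof cases
      case 1
      then show ?thesis by (intro T) auto
    next
      case 2
      then show ?thesis using level(1)[OF F 2, of i'] IH i'(1) by simp
    next
      case 3
      then show ?thesis using level(2)[OF F 3, of k] IH i'(1) by simp
    qed
  qed
qed auto

end

section \<open>Family (F2) with root 1 or -1\<close>

lemma trace_basis_order_1:
  "trace_basis 1 (1 :: 'k::field_char_0) {(i, 0, k) | i k. True}" (is "trace_basis _ _ ?T")
proof (rule trace_basisI)
  fix i j k assume "(i, j, k) \<in> ?T"
  then show "\<exists>F :: nat \<Rightarrow> nat \<Rightarrow> nat \<Rightarrow> 'k. tracial 1 1 F \<and> F i j k = 1 \<and>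
      (\<forall>i' j' k'. (i', j', k') \<in> ?T \<longrightarrow> (i', j', k') \<noteq> (i, j, k) \<longrightarrow> F i' j' k' = 0)"
    by (intro exI[of _ "delta_function i k"]) (auto simp: delta_function_def intro: tracial_delta_function)
next
  fix F :: "nat \<Rightarrow> nat \<Rightarrow> nat \<Rightarrow> 'k" and i j k :: nat
  assume F: "tracial 1 1 F" and T: "\<And>i j k. (i, j, k) \<in> ?T \<Longrightarrow> F i j k = 0"
  have g: "cross_coeff 1 (1 :: 'k) k = of_nat k" for k
    by (induction k) auto
  show "F i j k = 0"
  proof (cases j)
    case 0
    then show ?thesis by (auto intro: T)
  next
    case (Suc j')
    \<comment> \<open>All coefficients on the left are 0, so F is free for j = 0, while for j > 0
      the right-hand side (k + 1) F i j k must be 0.\<close>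
    have "of_nat (Suc k) * F i j k = 0"
      using tracialD(1)[OF F, of j' "Suc k" i] unfolding g Suc by simp
    then show ?thesis by (metis mult_eq_0_iff of_nat_eq_0_iff nat.simps(3))
  qed
qed auto

lemma trace_basis_order_2:
  "trace_basis (- 1) (- 1 :: 'k::field_char_0)
    ({(2 * i, 0, 2 * k) | i k. True} \<union> {(2 * i + 1, 0, 0) | i. True} \<union> {(0, 0, 2 * k + 1) | k. True} \<union>
     {(0, 2 * j + 1, 0) | j. True})" (is "trace_basis _ _ ?T")
proof (rule trace_basisI)
  interpret inverse_roots "- 1 :: 'k" "- 1" by unfold_locales simp
  fix i j k assume t: "(i, j, k) \<in> ?T"
  then consider "j = 0" | "i = 0" "k = 0" "odd j" by auto
  then show "\<exists>F :: nat \<Rightarrow> nat \<Rightarrow> nat \<Rightarrow> 'k. tracial (- 1) (- 1) F \<and> F i j k = 1 \<and>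
      (\<forall>i' j' k'. (i', j', k') \<in> ?T \<longrightarrow> (i', j', k') \<noteq> (i, j, k) \<longrightarrow> F i' j' k' = 0)"
  proof cases
    case 1
    then have "(even i \<and> even k) \<or> i = 0 \<or> k = 0" using t by auto
    then have "tracial (- 1) (- 1 :: 'k) (delta_function i k)"
      by (intro tracial_delta_function) auto
    with 1 show ?thesis
      by (intro exI[of _ "delta_function i k"]) (auto simp: delta_function_def)
  next
    case 2
    \<comment> \<open>The exponents along the diagonal line add up to j, so for odd j every
      coefficient is 1 - (-1)^j = 2.\<close>
    have tracial: "tracial (- 1) (- 1 :: 'k) (line_function (- 1) (- 1) 0 j 0)"
    proof (rule tracial_line_function)
      fix l assume "l \<le> 0 + j" "(- 1) ^ (j + 0 - l) * (- 1) ^ l = (1 :: 'k)"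
      then have "(- 1) ^ j = (1 :: 'k)" by (simp flip: power_add)
      with 2 show "\<exists>m>0. m \<le> l \<and> cross_coeff (- 1) (- 1 :: 'k) m = 0" by simp
    qed auto
    have zero: "line_function (- 1) (- 1 :: 'k) 0 j 0 i' j' k' = 0"
      if "(i', j', k') \<in> ?T" "(i', j', k') \<noteq> (0, j, 0)" for i' j' k'
      using that 2 by (auto simp: line_function_def)
    show ?thesis
      unfolding 2(1,2)
      by (rule exI[of _ "line_function (- 1) (- 1) 0 j 0"], intro conjI allI impI)
        (rule tracial, rule line_function_start, rule zero)
  qed
next
  fix i j k assume "(i, j, k) \<in> ?T"
  then show "(k, j, i) \<in> ?T" by auto
next
  interpret inverse_roots "- 1 :: 'k" "- 1" by unfold_locales simp
  fix F :: "nat \<Rightarrow> nat \<Rightarrow> nat \<Rightarrow> 'k" and i j k :: nat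
  assume F: "tracial (- 1) (- 1) F" and T: "\<And>i j k. (i, j, k) \<in> ?T \<Longrightarrow> F i j k = 0"
  assume ki: "k \<le> i"
  have g: "g m = (- 1) ^ m * of_nat m" for m
    by (induction m) (auto simp: algebra_simps)
  have neg: "(- 1) ^ a \<noteq> (- 1 :: 'k) ^ b" if "odd (a + b)" for a b
    using that by (auto simp: minus_one_power_iff)
  have mult_zero: "x = 0" if "g (Suc m) * x = 0" for m x
    using that unfolding g by (simp del: of_nat_Suc)
  \<comment> \<open>An equation with even exponent sum has coefficient 0 on the left and a nonzero
    factor on the right. Hence for positive middle index only triples with both outer indices of the
    opposite parity survive.\<close>
  have even_zero: "F i (Suc j) k = 0" if "even (Suc j + i) \<or> even (Suc j + k)" for i j k
    using that
  proof
    assume "even (Suc j + k)"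
    then have "(- 1) ^ j * (- 1) ^ Suc k = (1 :: 'k)" by (simp flip: power_add)
    then show ?thesis using tracialD(1)[OF F, of j "Suc k" i] mult_zero[of k] by simp
  next
    assume "even (Suc j + i)"
    then have "(- 1) ^ Suc i * (- 1) ^ j = (1 :: 'k)" by (simp flip: power_add add: add.commute)
    then show ?thesis using tracialD(2)[OF F, of "Suc i" j k] mult_zero[of i] by simp
  qed
  \<comment> \<open>The sum j + k is constant along a line, so when it is odd the coefficient is 2
    at every step back to k = 0.\<close>
  have pos_zero: "F i (Suc j) k = 0" if "k \<le> i" for i j k
    using that
  proof (induction k arbitrary: i j)
    case 0
    show ?case
    proof (cases i)
      case [simp]: 0
      show ?thesis
      proof (cases "odd j")
        case True
        then show ?thesis by (intro even_zero) auto
      next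
        case False
        then obtain l where "j = 2 * l" by auto
        then show ?thesis by (intro T) auto
      qed
    next
      case (Suc i')
      show ?thesis
      proof (cases "odd j")
        case True
        then show ?thesis by (intro even_zero) auto
      next
        case False
        then show ?thesis unfolding Suc by (intro level(1)[OF F] neg) auto
      qed
    qed
  next
    case (Suc k)
    then obtain i' where i': "i = Suc i'" "k \<le> i'" by (cases i) auto
    show ?case
    proof (cases "even (Suc j + Suc k)")
      case True
      then show ?thesis by (intro even_zero) auto
    next
      case False
      then show ?thesis
        unfolding i'(1) using Suc.IH[OF i'(2), of "Suc j"] by (intro level(1)[OF F] neg) auto
    qed
  qed
  show "F i j k = 0"
  proof (cases j)
    case [simp]: 0
    consider "even i" "even k" | "odd k" | "odd i" "k = 0" | "odd i" "k > 0" by auto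
    then show ?thesis
    proof cases
      case 1
      then obtain a b where "i = 2 * a" "k = 2 * b" by (auto elim!: evenE)
      then show ?thesis by (intro T) auto
    next
      case 2
      then obtain i' k' where ik: "i = Suc i'" "k = Suc k'" using ki by (cases i; cases k) auto
      then have "F i' (Suc 0) k' = 0" using ki by (intro pos_zero) auto
      with 2 ik level(1)[OF F neg, of 0 k i'] show ?thesis by simp
    next
      case 3
      then obtain a where "i = 2 * a + 1" by (auto elim!: oddE)
      with 3 show ?thesis by (intro T) auto
    next
      case 4
      then obtain i' k' where ik: "i = Suc i'" "k = Suc k'" using ki by (cases i; cases k) auto
      then have "F i' (Suc 0) k' = 0" using ki by (intro pos_zero) auto
      with 4 ik level(2)[OF F neg, of 0 i k'] show ?thesis by simp
    qed
  next
    case (Suc j')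
    then show ?thesis using pos_zero[OF ki] by simp
  qed
qed

section \<open>Family (F2) with root of order other than 1 and 2\<close>

lemma trace_basis_even_order:
  fixes q p :: "'k::field"
  assumes qp: "q * p = 1" and n: "even n" "n \<noteq> 2" "n = mult_order q"
  shows "trace_basis q p ({(i, j, k) | i j k. int n dvd int j - int i \<and> int n dvd int j - int k} \<union>
      {(i, 0, 0) | i. \<not> n dvd i} \<union> {(0, 0, k) | k. \<not> n dvd k} \<union> {(0, j, 0) | j. odd j})"
proof -
  have q: "q \<noteq> 0" using qp by auto
  note order = power_eq_iff_mult_order[OF q, folded n(3)] mult_order_dvd_iff[OF q, folded n(3)]
  have "q ^ 2 \<noteq> 1"
    unfolding order using n(1,2) by (metis dvd_antisym)
  then interpret inverse_roots_nondegenerate q p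
    using qp by unfold_locales
  have "trace_basis q p ({(i, j, k) | i j k. q ^ j = q ^ i \<and> q ^ j = q ^ k} \<union> {(i, 0, 0) | i. q ^ i \<noteq> 1} \<union>
      {(0, 0, k) | k. q ^ k \<noteq> 1} \<union> {(0, j, 0) | j. j \<in> {j. odd j}})"
  proof (rule trace_basis_nondegenerate)
    \<comment> \<open>A zero coefficient at l means that n divides j - 2l, impossible for even n and
      odd j.\<close>
    fix j l :: nat assume "j \<in> {j. odd j}" "l \<le> j"
    then obtain a where "j = l + a" "odd j" by (auto simp: le_iff_add)
    then have "odd (int (j - l) - int l)" by auto
    then show "q ^ (j - l) \<noteq> q ^ l"
      unfolding order using n(1) by (metis dvd_trans even_of_nat)
  next
    fix j assume j: "j \<notin> {j. odd j}" "q ^ j \<noteq> 1"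
    \<comment> \<open>The midpoint K = j / 2 is a witness; it is positive because q^j \<noteq>
      1.\<close>
    then obtain K where "j = 2 * K" by (auto elim!: evenE)
    with j show "\<exists>K\<ge>1. K \<le> j \<and> q ^ (j - K) = q ^ K"
      by (intro exI[of _ K]) (cases K; auto)
  qed
  then show ?thesis unfolding order by simp
qed

lemma trace_basis_odd_order:
  fixes q p :: "'k::field"
  assumes qp: "q * p = 1" and n: "odd n" "n \<noteq> 1" "n = mult_order q"
  shows "trace_basis q p ({(i, j, k) | i j k. int n dvd int j - int i \<and> int n dvd int j - int k} \<union>
      {(i, 0, 0) | i. \<not> n dvd i} \<union> {(0, 0, k) | k. \<not> n dvd k} \<union> {(0, j, 0) | j. odd j \<and> j \<le> n - 2})"
proof -
  have q: "q \<noteq> 0" using qp by auto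
  note order = power_eq_iff_mult_order[OF q, folded n(3)] mult_order_dvd_iff[OF q, folded n(3)]
  have n3: "n \<ge> 3"
    using n(1,2) by (cases n) (auto elim!: oddE)
  have "q ^ 2 \<noteq> 1"
    unfolding order using n3 by (auto dest: dvd_imp_le)
  then interpret inverse_roots_nondegenerate q p
    using qp by unfold_locales
  have "trace_basis q p ({(i, j, k) | i j k. q ^ j = q ^ i \<and> q ^ j = q ^ k} \<union> {(i, 0, 0) | i. q ^ i \<noteq> 1} \<union>
      {(0, 0, k) | k. q ^ k \<noteq> 1} \<union> {(0, j, 0) | j. j \<in> {j. odd j \<and> j \<le> n - 2}})"
  proof (rule trace_basis_nondegenerate)
    \<comment> \<open>Here j - 2l is odd, hence nonzero, and its absolute value is at most j <
      n.\<close>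
    fix j l :: nat assume jl: "j \<in> {j. odd j \<and> j \<le> n - 2}" "l \<le> j"
    then obtain a where "j = l + a" "odd j" by (auto simp: le_iff_add)
    then have "odd (int (j - l) - int l)" by auto
    then have "int (j - l) - int l \<noteq> 0" by (metis dvd_0_right)
    moreover have "\<bar>int (j - l) - int l\<bar> < int n" using jl n3 by auto
    ultimately show "q ^ (j - l) \<noteq> q ^ l"
      unfolding order by (metis abs_of_nat dvd_imp_le_int leD)
  next
    fix j assume j: "j \<notin> {j. odd j \<and> j \<le> n - 2}" "q ^ j \<noteq> 1"
    show "\<exists>K\<ge>1. K \<le> j \<and> q ^ (j - K) = q ^ K"
    proof (cases "even j")
      case True
      then obtain K where "j = 2 * K" by (auto elim!: evenE)
      with j show ?thesis
        by (intro exI[of _ K]) (cases K; auto)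
    next
      case False
      have qn: "q ^ n = 1" by (simp add: order)
      with j(2) have "j \<noteq> n" by auto
      moreover have "j \<noteq> n - 1" using n(1) False by auto
      ultimately have "j > n" using j(1) False n3 by auto
      \<comment> \<open>The witness K = (j - n) / 2 satisfies j - K = n + K.\<close>
      moreover obtain K where "j - n = 2 * K"
        using False n(1) \<open>j > n\<close> by (metis dvd_def even_diff_nat odd_even_add)
      ultimately have K: "j = n + K + K" "K \<ge> 1" by auto
      then have "q ^ (j - K) = q ^ K" using qn by (simp add: power_add)
      with K show ?thesis by auto
    qed
  qed
  then show ?thesis unfolding order by simp
qed

section \<open>Transport to the statement\<close>

lemma image_setcompr:
  "f ` {t x | x. P x} = {f (t x) | x. P x}"
  "f ` {t2 x y | x y. P2 x y} = {f (t2 x y) | x y. P2 x y}"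
  "f ` {t3 x y z | x y z. P3 x y z} = {f (t3 x y z) | x y z. P3 x y z}"
  by blast+

context free_alg_quotient
begin

lemma w_eq_coset_free_w:
  "(- (p * q)) \<odot> (coset (free_gen U) \<otimes> coset (free_gen D)) \<oplus>
    q \<odot> (coset (free_gen D) \<otimes> coset (free_gen U)) = coset (free_w q p)"
  by (simp add: coset_mult Q.map_scale Q.map_add free_w_def)

text \<open>One equation per shape of monomial in the theorem, where factors with exponent 0 are not
  written.\<close>

lemma monomial_eq_coset_pbw:
  "coset (free_gen U) [^] i \<otimes> coset (free_w q p) [^] j \<otimes> coset (free_gen D) [^] k = coset (pbw q p i j k)"
  "coset (free_gen U) [^] i \<otimes> coset (free_gen D) [^] k = coset (pbw q p i 0 k)"
  "coset (free_gen U) [^] i = coset (pbw q p i 0 0)"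
  "coset (free_w q p) [^] j = coset (pbw q p 0 j 0)"
  "coset (free_gen D) [^] k = coset (pbw q p 0 0 k)"
  "\<one> = coset (pbw q p 0 0 0)"
  by (simp_all add: coset_mult coset_pow coset_one pbw_def)

end

theorem proposition3p3:
  fixes \<alpha> \<beta> r1 r2 :: "'k::field_char_0"
    and A (structure) and u d w n
  assumes roots: "[:-\<beta>, -\<alpha>, 1:] = [:-r1, 1:] * [:-r2, 1:]"
  defines "A \<equiv> down_up_algebra \<alpha> \<beta>"
    and "u \<equiv> down_up_gen \<alpha> \<beta> U"
    and "d \<equiv> down_up_gen \<alpha> \<beta> D"
    and "w \<equiv> \<beta> \<odot> (u \<otimes> d) \<oplus> r1 \<odot> (d \<otimes> u)"
    and "n \<equiv> mult_order r1"
  shows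
    "(family_F1 \<alpha> \<beta> r1 r2 \<longrightarrow>
        classes_form_basis_HH0 A
          ({\<one>} \<union> {w [^] j | j::nat. j \<ge> 1} \<union> {d [^] j | j::nat. j \<ge> 1} \<union> {u [^] j | j::nat. j \<ge> 1}))
     \<and>
     (family_F2 \<beta> \<longrightarrow>
        (even n \<and> n \<noteq> 2 \<longrightarrow>
          classes_form_basis_HH0 A
            ({u [^] i \<otimes> w [^] j \<otimes> d [^] k | (i::nat) (j::nat) (k::nat).
                int n dvd int j - int i \<and> int n dvd int j - int k}
             \<union> {u [^] i | i::nat. \<not> n dvd i} \<union> {d [^] k | k::nat. \<not> n dvd k}
             \<union> {w [^] j | j::nat. odd j}))
      \<and> (odd n \<and> n \<noteq> 1 \<longrightarrow>
          classes_form_basis_HH0 A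
            ({u [^] i \<otimes> w [^] j \<otimes> d [^] k | (i::nat) (j::nat) (k::nat).
                int n dvd int j - int i \<and> int n dvd int j - int k}
             \<union> {u [^] i | i::nat. \<not> n dvd i} \<union> {d [^] k | k::nat. \<not> n dvd k}
             \<union> {w [^] j | j::nat. odd j \<and> j \<le> n - 2}))
      \<and> (n = 2 \<longrightarrow>
          classes_form_basis_HH0 A
            ({u [^] (2 * i) \<otimes> d [^] (2 * k) | (i::nat) (k::nat). True}
             \<union> {u [^] (2 * i + 1) | i::nat. True} \<union> {d [^] (2 * k + 1) | k::nat. True}
             \<union> {w [^] (2 * j + 1) | j::nat. True}))
      \<and> (n = 1 \<longrightarrow>
          classes_form_basis_HH0 A {u [^] i \<otimes> d [^] k | (i::nat) (k::nat). True}))"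
proof -
  define I where "I = down_up_ideal \<alpha> \<beta>"
  interpret Q: free_alg_quotient I A
    by (simp add: free_alg_quotient_def I_def A_def down_up_algebra_def ideal_down_up_ideal)
  \<comment> \<open>The order of the operands matches \<open>p + q\<close> and \<open>p * q\<close>
    with q = r1 and p = r2, on which the later folding of \<alpha> and \<beta> relies.\<close>
  have "- \<beta> = r2 * r1" and \<alpha>: "\<alpha> = r2 + r1"
    using roots by (auto simp: algebra_simps)
  then have \<beta>: "\<beta> = - (r2 * r1)"
    by (metis minus_minus)
  let ?e = "\<lambda>(i, j, k). Q.coset (pbw r1 r2 i j k)"
  have w: "w = Q.coset (free_w r1 r2)"
    using Q.w_eq_coset_free_w[of r2 r1, folded \<beta>]
    unfolding w_def u_def d_def down_up_gen_def I_def[symmetric] .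
  note gens = u_def[unfolded down_up_gen_def, folded I_def] d_def[unfolded down_up_gen_def, folded I_def] w
  note monomial = Q.monomial_eq_coset_pbw[where q = r1 and p = r2, folded gens]
  have basis: "classes_form_basis_HH0 A (?e ` T)" if "r1 \<noteq> 0" "trace_basis r1 r2 T" for T
    using classes_form_basis_HH0_if_trace_basis[OF that]
    unfolding A_def I_def \<alpha>[symmetric] \<beta>[symmetric] .
  have roots_F2: "r1 * r2 = 1" "r1 \<noteq> 0" if "family_F2 \<beta>"
    using that \<beta> by (auto simp: family_F2_def mult.commute)
  show ?thesis
  proof (intro conjI impI)
    assume F1: "family_F1 \<alpha> \<beta> r1 r2"
    have "a = 0 \<and> b = 0" if "r1 ^ a * r2 ^ b = 1" for a b :: nat
    proof -
      have "r1 powi int a * r2 powi int b = 1" using that by simp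
      with F1 have "(int a, int b) = (0, 0)" unfolding family_F1_def by blast
      then show ?thesis by simp
    qed
    then have T: "trace_basis r1 r2 ({(0, 0, 0)} \<union> {(0, j, 0) | j. j \<ge> 1} \<union> {(0, 0, k) | k. k \<ge> 1} \<union>
        {(i, 0, 0) | i. i \<ge> 1})"
      by (rule trace_basis_generic)
    have r1: "r1 \<noteq> 0" using F1 by (simp add: family_F1_def)
    have eq: "?e ` {(0, 0, 0)} = {\<one>}"
      by (simp only: monomial(6) image_insert image_empty prod.case)
    have eqs: "?e ` {(0, j, 0) | j. j \<ge> 1} = {w [^] j | j::nat. j \<ge> 1}"
        "?e ` {(0, 0, k) | k. k \<ge> 1} = {d [^] k | k::nat. k \<ge> 1}"
        "?e ` {(i, 0, 0) | i. i \<ge> 1} = {u [^] i | i::nat. i \<ge> 1}"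
      by (simp_all only: monomial(3-5) image_setcompr prod.case)
    show "classes_form_basis_HH0 A
        ({\<one>} \<union> {w [^] j | j::nat. j \<ge> 1} \<union> {d [^] j | j::nat. j \<ge> 1} \<union> {u [^] j | j::nat. j \<ge> 1})"
      using basis[OF r1 T] unfolding image_Un eq eqs .
  next
    assume F2: "family_F2 \<beta>" and n: "even n \<and> n \<noteq> 2"
    note qp = roots_F2[OF F2]
    have n': "even n" "n \<noteq> 2" "n = mult_order r1" using n by (auto simp: n_def)
    have eq: "?e ` {(i, j, k) | i j k. int n dvd int j - int i \<and> int n dvd int j - int k} =
          {u [^] i \<otimes> w [^] j \<otimes> d [^] k | (i::nat) (j::nat) (k::nat). int n dvd int j - int i \<and> int n dvd int j - int k}"
      by (simp only: monomial(1) image_setcompr prod.case)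
    have eqs: "?e ` {(i, 0, 0) | i. \<not> n dvd i} = {u [^] i | i::nat. \<not> n dvd i}"
        "?e ` {(0, 0, k) | k. \<not> n dvd k} = {d [^] k | k::nat. \<not> n dvd k}"
        "?e ` {(0, j, 0) | j. odd j} = {w [^] j | j::nat. odd j}"
      by (simp_all only: monomial(3-5) image_setcompr prod.case)
    show "classes_form_basis_HH0 A
        ({u [^] i \<otimes> w [^] j \<otimes> d [^] k | (i::nat) (j::nat) (k::nat).
            int n dvd int j - int i \<and> int n dvd int j - int k}
         \<union> {u [^] i | i::nat. \<not> n dvd i} \<union> {d [^] k | k::nat. \<not> n dvd k}
         \<union> {w [^] j | j::nat. odd j})"
      using basis[OF qp(2) trace_basis_even_order[OF qp(1) n']] unfolding image_Un eq eqs .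
  next
    assume F2: "family_F2 \<beta>" and n: "odd n \<and> n \<noteq> 1"
    note qp = roots_F2[OF F2]
    have n': "odd n" "n \<noteq> 1" "n = mult_order r1" using n by (auto simp: n_def)
    have eq: "?e ` {(i, j, k) | i j k. int n dvd int j - int i \<and> int n dvd int j - int k} =
          {u [^] i \<otimes> w [^] j \<otimes> d [^] k | (i::nat) (j::nat) (k::nat). int n dvd int j - int i \<and> int n dvd int j - int k}"
      by (simp only: monomial(1) image_setcompr prod.case)
    have eqs: "?e ` {(i, 0, 0) | i. \<not> n dvd i} = {u [^] i | i::nat. \<not> n dvd i}"
        "?e ` {(0, 0, k) | k. \<not> n dvd k} = {d [^] k | k::nat. \<not> n dvd k}"
        "?e ` {(0, j, 0) | j. odd j \<and> j \<le> n - 2} = {w [^] j | j::nat. odd j \<and> j \<le> n - 2}"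
      by (simp_all only: monomial(3-5) image_setcompr prod.case)
    show "classes_form_basis_HH0 A
        ({u [^] i \<otimes> w [^] j \<otimes> d [^] k | (i::nat) (j::nat) (k::nat).
            int n dvd int j - int i \<and> int n dvd int j - int k}
         \<union> {u [^] i | i::nat. \<not> n dvd i} \<union> {d [^] k | k::nat. \<not> n dvd k}
         \<union> {w [^] j | j::nat. odd j \<and> j \<le> n - 2})"
      using basis[OF qp(2) trace_basis_odd_order[OF qp(1) n']] unfolding image_Un eq eqs .
  next
    assume F2: "family_F2 \<beta>" and n: "n = 2"
    note qp = roots_F2[OF F2]
    have "r1 ^ 2 = 1" "r1 ^ 1 \<noteq> 1"
      unfolding mult_order_dvd_iff[OF qp(2)] using n by (auto simp: n_def)
    then have r: "r1 = - 1" "r2 = - 1" using qp by (auto simp: power2_eq_1_iff minus_equation_iff)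
    have trace_basis_r: "trace_basis r1 r2 T \<longleftrightarrow> trace_basis (- 1 :: 'k) (- 1) T" for T
      by (simp add: r)
    have eq: "?e ` {(2 * i, 0, 2 * k) | i k. True} = {u [^] (2 * i) \<otimes> d [^] (2 * k) | (i::nat) (k::nat). True}"
      by (simp only: monomial(2) image_setcompr prod.case)
    have eqs: "?e ` {(2 * i + 1, 0, 0) | i. True} = {u [^] (2 * i + 1) | i::nat. True}"
        "?e ` {(0, 0, 2 * k + 1) | k. True} = {d [^] (2 * k + 1) | k::nat. True}"
        "?e ` {(0, 2 * j + 1, 0) | j. True} = {w [^] (2 * j + 1) | j::nat. True}"
      by (simp_all only: monomial(3-5) image_setcompr prod.case)
    show "classes_form_basis_HH0 A
        ({u [^] (2 * i) \<otimes> d [^] (2 * k) | (i::nat) (k::nat). True}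
         \<union> {u [^] (2 * i + 1) | i::nat. True} \<union> {d [^] (2 * k + 1) | k::nat. True}
         \<union> {w [^] (2 * j + 1) | j::nat. True})"
      using basis[OF qp(2) iffD2[OF trace_basis_r trace_basis_order_2]] unfolding image_Un eq eqs .
  next
    assume F2: "family_F2 \<beta>" and n: "n = 1"
    note qp = roots_F2[OF F2]
    have "r1 ^ 1 = 1"
      unfolding mult_order_dvd_iff[OF qp(2)] using n by (simp add: n_def)
    then have "r1 = 1" "r2 = 1" using qp by auto
    then have T: "trace_basis r1 r2 {(i, 0, k) | i k. True}"
      using trace_basis_order_1 by simp
    have eq: "?e ` {(i, 0, k) | i k. True} = {u [^] i \<otimes> d [^] k | (i::nat) (k::nat). True}"
      by (simp only: monomial(2) image_setcompr prod.case)
    show "classes_form_basis_HH0 A {u [^] i \<otimes> d [^] k | (i::nat) (k::nat). True}"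
      using basis[OF qp(2) T] unfolding eq .
  qed
qed

end
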